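(* For every natural number $k \geq 2$ there exist a natural number $\ell$ and a constant $c_k > 0$ (depending only on $k$) such that $\mathrm{ex}(n, \theta_{k,\ell}) \geq c_k\, n^{1+1/k}$ for all sufficiently large $n$. That is, $\mathrm{ex}(n, \theta_{k, \ell}) = \Omega_k(n^{1 + 1/k})$.
   Context: For a graph $H$, $\mathrm{ex}(n,H)$ denotes the maximum number of edges in a graph on $n$ vertices that contains no (not necessarily induced) subgraph isomorphic to $H$. For natural numbers $k$ and $\ell$, $\theta_{k,\ell}$ denotes the graph consisting of $\ell$ internally vertex-disjoint paths, each of length $k$ (i.e. with $k$ edges), all having the same two endpoints. The notation $\Omega_k$ means the implied constant depends only on $k$. *)

theory Defs
  imports Complex_Main
begin

record 'a sgraph =
  verts :: "'a set"
  edges :: "'a set set"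

definition finite_simple_graph :: "'a sgraph \<Rightarrow> bool" where
  "finite_simple_graph G \<longleftrightarrow>
     finite (verts G) \<and> (\<forall>e \<in> edges G. e \<subseteq> verts G \<and> card e = 2)"

text \<open>Subgraphs need not be induced.\<close>

definition is_subgraph :: "'a sgraph \<Rightarrow> 'a sgraph \<Rightarrow> bool" where
  "is_subgraph K G \<longleftrightarrow>
     finite_simple_graph K \<and> verts K \<subseteq> verts G \<and> edges K \<subseteq> edges G"

definition isomorphic :: "'a sgraph \<Rightarrow> 'b sgraph \<Rightarrow> bool" where
  "isomorphic K H \<longleftrightarrow>
     (\<exists>f. bij_betw f (verts K) (verts H) \<and>
          (\<forall>u \<in> verts K. \<forall>v \<in> verts K. {u, v} \<in> edges K \<longleftrightarrow> {f u, f v} \<in> edges H))"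

definition contains_copy :: "'a sgraph \<Rightarrow> 'b sgraph \<Rightarrow> bool" where
  "contains_copy G H \<longleftrightarrow> (\<exists>K. is_subgraph K G \<and> isomorphic K H)"

text \<open>
  Every finite graph is isomorphic to one whose vertices are natural numbers, so it suffices
  to range over those. The maximum is over a finite set, which is nonempty whenever \<open>H\<close> has
  an edge.
\<close>

definition edge_counts_avoiding :: "nat \<Rightarrow> 'b sgraph \<Rightarrow> nat set" where
  "edge_counts_avoiding n H =
     {card (edges G) | G :: nat sgraph.
        finite_simple_graph G \<and> card (verts G) = n \<and> \<not> contains_copy G H}"

definition extremal_number :: "nat \<Rightarrow> 'b sgraph \<Rightarrow> nat" where
  "extremal_number n H = Max (edge_counts_avoiding n H)"

text \<open>
  \<open>Inner i j\<close> is the vertex at distance \<open>j\<close> from \<open>Source\<close> along the \<open>i\<close>-th path, for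
  \<open>0 < j < k\<close>; all paths share their ends \<open>Source\<close> and \<open>Sink\<close>.
\<close>

datatype theta_vertex = Source | Sink | Inner nat nat

definition theta_point :: "nat \<Rightarrow> nat \<Rightarrow> nat \<Rightarrow> theta_vertex" where
  "theta_point k i j = (if j = 0 then Source else if j = k then Sink else Inner i j)"

definition theta :: "nat \<Rightarrow> nat \<Rightarrow> theta_vertex sgraph" where
  "theta k l =
     \<lparr>verts = {Source, Sink} \<union> {Inner i j | i j. i < l \<and> 0 < j \<and> j < k},
      edges = {{theta_point k i j, theta_point k i (Suc j)} | i j. i < l \<and> j < k}\<rparr>"

lemma finite_edge_counts_avoiding: "finite (edge_counts_avoiding n H)"
proof (rule finite_subset)
  show "edge_counts_avoiding n H \<subseteq> {..2 ^ n}"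
  proof
    fix m assume "m \<in> edge_counts_avoiding n H"
    then obtain G :: "nat sgraph" where G: "m = card (edges G)" "finite_simple_graph G"
      "card (verts G) = n"
      unfolding edge_counts_avoiding_def by blast
    have "edges G \<subseteq> Pow (verts G)" "finite (verts G)"
      using G(2) unfolding finite_simple_graph_def by blast+
    then have "card (edges G) \<le> card (Pow (verts G))"
      by (intro card_mono) auto
    then show "m \<in> {..2 ^ n}"
      using G \<open>finite (verts G)\<close> by (simp add: card_Pow)
  qed
qed simp

lemma edge_counts_avoiding_nonempty:
  assumes "finite_simple_graph H" "edges H \<noteq> {}"
  shows "edge_counts_avoiding n H \<noteq> {}"
proof -
  define G :: "nat sgraph" where "G = \<lparr>verts = {..<n}, edges = {}\<rparr>"
  obtain e where e: "e \<in> edges H" "e \<subseteq> verts H" "card e = 2"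
    using assms unfolding finite_simple_graph_def by blast
  then obtain x y where xy: "e = {x, y}" unfolding card_2_iff by blast
  have "\<not> contains_copy G H"
  proof
    assume "contains_copy G H"
    then obtain K :: "nat sgraph" and f where "is_subgraph K G"
      and f: "bij_betw f (verts K) (verts H)"
      and iso: "\<forall>u \<in> verts K. \<forall>v \<in> verts K. {u, v} \<in> edges K \<longleftrightarrow> {f u, f v} \<in> edges H"
      unfolding contains_copy_def isomorphic_def by blast
    then have K: "edges K = {}" by (simp add: is_subgraph_def G_def)
    have "x \<in> f ` verts K" "y \<in> f ` verts K"
      using e(2) xy f unfolding bij_betw_def by blast+
    then obtain u v where "u \<in> verts K" "v \<in> verts K" "x = f u" "y = f v" by blast
    then show False using K iso e(1) xy by blast
  qed
  then have "card (edges G) \<in> edge_counts_avoiding n H"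
    unfolding edge_counts_avoiding_def
    by (intro CollectI exI[of _ G]) (simp add: finite_simple_graph_def G_def)
  then show ?thesis by blast
qed

lemma finite_simple_graph_theta:
  assumes "k \<ge> 2"
  shows "finite_simple_graph (theta k l)"
proof -
  have "{Inner i j | i j. i < l \<and> 0 < j \<and> j < k} \<subseteq> (\<lambda>(i, j). Inner i j) ` ({..<l} \<times> {..<k})"
    by auto
  then have "finite {Inner i j | i j. i < l \<and> 0 < j \<and> j < k}"
    by (rule finite_subset) simp
  then have "finite (verts (theta k l))" by (simp add: theta_def)
  moreover have "{theta_point k i j, theta_point k i (Suc j)} \<subseteq> verts (theta k l)"
    "card {theta_point k i j, theta_point k i (Suc j)} = 2" if "i < l" "j < k" for i j
    using that assms by (auto simp: theta_def theta_point_def)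
  ultimately show ?thesis
    unfolding finite_simple_graph_def by (auto simp: theta_def)
qed

lemma edges_theta_nonempty:
  assumes "k \<ge> 2" "l \<ge> 1"
  shows "edges (theta k l) \<noteq> {}"
proof -
  have "{theta_point k 0 0, theta_point k 0 (Suc 0)} \<in> edges (theta k l)"
    using assms unfolding theta_def sgraph.simps
    by (intro CollectI exI[of _ "0 :: nat"] conjI refl) auto
  then show ?thesis by blast
qed

end

(*
  Lower bound by a random algebraic construction over F_q with q = 2^t: the vertices are the
  points of F_q^k, and two points are joined when k - 1 symmetric forms with random coefficients
  in F_q vanish. The paths of length k between two given points form an algebraic set over an
  algebraically closed field of characteristic 2 and infinite transcendence degree, so by
  quantifier elimination either there are at most C of them, or the algebraic set is infinite.
  Instead of estimating point counts (Lang-Weil), the proof bounds the dimension of the set of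
  coefficient vectors for which the algebraic set is infinite: a generic point of it, together
  with s independent points on the set of paths, would have too large a transcendence degree,
  because the edges of the union of s paths outnumber its inner vertices. Hence a bad coefficient
  vector is so unlikely that averaging gives one without bad pairs and with many edges.
*)

theory Submission
  imports Defs
    "HOL-Library.Countable_Set"
    "HOL-Library.Z2"
    "HOL-Computational_Algebra.Formal_Laurent_Series"
    "HOL-Algebra.Algebraic_Closure_Type"
begin

section \<open>Quantifier elimination for algebraically closed fields\<close>

inductive_set polyfun :: "(('v \<Rightarrow> 'a::comm_ring_1) \<Rightarrow> 'a) set" where
  one: "(\<lambda>_. 1) \<in> polyfun"
| var: "(\<lambda>e. e v) \<in> polyfun"
| add: "f \<in> polyfun \<Longrightarrow> g \<in> polyfun \<Longrightarrow> (\<lambda>e. f e + g e) \<in> polyfun"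
| diff: "f \<in> polyfun \<Longrightarrow> g \<in> polyfun \<Longrightarrow> (\<lambda>e. f e - g e) \<in> polyfun"
| mult: "f \<in> polyfun \<Longrightarrow> g \<in> polyfun \<Longrightarrow> (\<lambda>e. f e * g e) \<in> polyfun"

lemma polyfun_zero: "(\<lambda>_. 0) \<in> polyfun"
  using polyfun.diff[OF polyfun.one polyfun.one] by simp

lemma polyfun_sum:
  assumes "\<And>i. i \<in> A \<Longrightarrow> f i \<in> polyfun"
  shows "(\<lambda>e. \<Sum>i\<in>A. f i e) \<in> polyfun"
  using assms
  by (induction A rule: infinite_finite_induct) (auto intro: polyfun.intros polyfun_zero)

lemma polyfun_power: "f \<in> polyfun \<Longrightarrow> (\<lambda>e. f e ^ n) \<in> polyfun"
  by (induction n) (auto intro: polyfun.intros)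

inductive_set definable :: "(('v \<Rightarrow> 'a::comm_ring_1) \<Rightarrow> bool) set" where
  zero: "f \<in> polyfun \<Longrightarrow> (\<lambda>e. f e = 0) \<in> definable"
| neg: "P \<in> definable \<Longrightarrow> (\<lambda>e. \<not> P e) \<in> definable"
| conj: "P \<in> definable \<Longrightarrow> Q \<in> definable \<Longrightarrow> (\<lambda>e. P e \<and> Q e) \<in> definable"

lemma definable_disj:
  assumes "P \<in> definable" "Q \<in> definable"
  shows "(\<lambda>e. P e \<or> Q e) \<in> definable"
  using definable.neg[OF definable.conj[OF definable.neg[OF assms(1)] definable.neg[OF assms(2)]]]
  by simp

lemma definable_True: "(\<lambda>_. True) \<in> definable"
  using definable.zero[OF polyfun_zero] by simp

lemma definable_False: "(\<lambda>_. False) \<in> definable"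
  using definable.neg[OF definable_True] by simp

lemma definable_ball:
  assumes "finite A" "\<And>x. x \<in> A \<Longrightarrow> P x \<in> definable"
  shows "(\<lambda>e. \<forall>x\<in>A. P x e) \<in> definable"
  using assms by (induction A) (auto intro: definable_True definable.conj)

lemma definable_bex:
  assumes "finite A" "\<And>x. x \<in> A \<Longrightarrow> P x \<in> definable"
  shows "(\<lambda>e. \<exists>x\<in>A. P x e) \<in> definable"
  using assms by (induction A) (auto intro: definable_False definable_disj)

lemma definable_eq:
  assumes "f \<in> polyfun" "g \<in> polyfun"
  shows "(\<lambda>e. f e = g e) \<in> definable"
  using definable.zero[OF polyfun.diff[OF assms]] by simp

text \<open>Polynomials in the variable \<open>i\<close> whose coefficients do not involve \<open>i\<close>;
  \<open>n\<close> bounds the length of the coefficient list, so \<open>n = 0\<close> means the zero polynomial.\<close>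

definition parpoly :: "'v \<Rightarrow> nat \<Rightarrow> (('v \<Rightarrow> 'a::comm_ring_1) \<Rightarrow> 'a poly) set" where
  "parpoly i n = {p. (\<forall>j. (\<lambda>e. coeff (p e) j) \<in> polyfun)
      \<and> (\<forall>e x. p (e(i := x)) = p e) \<and> (\<forall>e j. n \<le> j \<longrightarrow> coeff (p e) j = 0)}"

lemma parpolyD:
  assumes "p \<in> parpoly i n"
  shows "(\<lambda>e. coeff (p e) j) \<in> polyfun" "p (e(i := x)) = p e" "n \<le> j \<Longrightarrow> coeff (p e) j = 0"
  using assms by (auto simp: parpoly_def)

lemma parpoly_shrink:
  "p \<in> parpoly i n \<Longrightarrow> (\<And>e j. m \<le> j \<Longrightarrow> coeff (p e) j = 0) \<Longrightarrow> p \<in> parpoly i m"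
  unfolding parpoly_def by blast

lemma parpoly_degree:
  assumes "p \<in> parpoly i n" "p e \<noteq> 0"
  shows "degree (p e) < n"
  using parpolyD(3)[OF assms(1), of "degree (p e)" e] assms(2) by (metis leading_coeff_0_iff not_less)

lemma parpoly_add:
  "p \<in> parpoly i n \<Longrightarrow> q \<in> parpoly i m \<Longrightarrow> (\<lambda>e. p e + q e) \<in> parpoly i (max n m)"
  by (auto simp: parpoly_def intro!: polyfun.intros)

lemma parpoly_diff:
  "p \<in> parpoly i n \<Longrightarrow> q \<in> parpoly i m \<Longrightarrow> (\<lambda>e. p e - q e) \<in> parpoly i (max n m)"
  by (auto simp: parpoly_def intro!: polyfun.intros)

lemma parpoly_mult:
  assumes "p \<in> parpoly i n" "q \<in> parpoly i m"
  shows "(\<lambda>e. p e * q e) \<in> parpoly i (n + m)"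
proof -
  have "coeff (p e * q e) j = 0" if "n + m \<le> j" for e j
    unfolding coeff_mult
  proof (rule sum.neutral, safe)
    fix l assume "l \<le> j"
    show "coeff (p e) l * coeff (q e) (j - l) = 0"
    proof (cases "n \<le> l")
      case True
      then show ?thesis using parpolyD(3)[OF assms(1)] by simp
    next
      case False
      then have "m \<le> j - l" using that by simp
      then show ?thesis using parpolyD(3)[OF assms(2)] by simp
    qed
  qed
  then show ?thesis using assms
    by (auto simp: parpoly_def coeff_mult intro!: polyfun_sum polyfun.mult)
qed

lemma parpoly_power:
  fixes p :: "('v \<Rightarrow> 'a::comm_ring_1) \<Rightarrow> 'a poly"
  assumes "p \<in> parpoly i n"
  shows "\<exists>m. (\<lambda>e. p e ^ l) \<in> parpoly i m"
proof (induction l)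
  case 0
  have "(\<lambda>_. 1 :: 'a poly) \<in> parpoly i 1"
    by (auto simp: parpoly_def intro: polyfun.intros polyfun_zero)
  then show ?case by auto
next
  case (Suc l)
  then obtain m where "(\<lambda>e. p e ^ l) \<in> parpoly i m" by blast
  from parpoly_mult[OF assms this] show ?case by auto
qed

lemma parpoly_monom:
  assumes "p \<in> parpoly i n" 
  shows "(\<lambda>e. monom (coeff (p e) j) l) \<in> parpoly i (Suc l)"
proof -
  have "(\<lambda>e. coeff (monom (coeff (p e) j) l) m) \<in> polyfun" for m
    using parpolyD(1)[OF assms, of j] by (cases "l = m") (simp_all add: polyfun_zero)
  then show ?thesis using parpolyD(2)[OF assms] by (auto simp: parpoly_def)
qed

lemma parpoly_smult:
  assumes "p \<in> parpoly i n" "q \<in> parpoly i m"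
  shows "(\<lambda>e. smult (coeff (p e) j) (q e)) \<in> parpoly i m"
  using assms by (auto simp: parpoly_def intro: polyfun.mult)

lemma polyfun_parpoly:
  fixes f :: "('v \<Rightarrow> 'a::comm_ring_1) \<Rightarrow> 'a"
  assumes "f \<in> polyfun"
  shows "\<exists>n p. p \<in> parpoly i n \<and> (\<forall>e x. f (e(i := x)) = poly (p e) x)"
  using assms
proof induction
  case one
  have "(\<lambda>_. 1 :: 'a poly) \<in> parpoly i 1"
    by (auto simp: parpoly_def intro: polyfun.intros polyfun_zero)
  then show ?case by (metis poly_1)
next
  case (var v)
  show ?case
  proof (cases "v = i")
    case True
    have "(\<lambda>_. [:0, 1:]) \<in> parpoly i 2"
      by (auto simp: parpoly_def coeff_pCons split: nat.split intro: polyfun.intros polyfun_zero)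
    then show ?thesis
      using True by (intro exI[of _ 2] exI[of _ "\<lambda>_. [:0, 1:]"]) auto
  next
    case False
    have "(\<lambda>e :: 'v \<Rightarrow> 'a. [:e v:]) \<in> parpoly i 1"
    proof -
      have "(\<lambda>e :: 'v \<Rightarrow> 'a. coeff [:e v:] j) \<in> polyfun" for j
        by (cases j) (auto intro: polyfun.intros polyfun_zero)
      moreover have "coeff [:e v:] j = 0" if "1 \<le> j" for e :: "'v \<Rightarrow> 'a" and j
        using that by (cases j) auto
      ultimately show ?thesis
        unfolding parpoly_def using False by (intro CollectI conjI allI impI) auto
    qed
    then show ?thesis
      using False by (intro exI[of _ 1] exI[of _ "\<lambda>e. [:e v:]"]) auto
  qed
next
  case (add f g)
  then obtain n p m q where "p \<in> parpoly i n" "q \<in> parpoly i m"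
    "\<forall>e x. f (e(i := x)) = poly (p e) x" "\<forall>e x. g (e(i := x)) = poly (q e) x" by metis
  then show ?case
    by (intro exI[of _ "max n m"] exI[of _ "\<lambda>e. p e + q e"]) (simp add: parpoly_add del: fun_upd_apply)
next
  case (diff f g)
  then obtain n p m q where "p \<in> parpoly i n" "q \<in> parpoly i m"
    "\<forall>e x. f (e(i := x)) = poly (p e) x" "\<forall>e x. g (e(i := x)) = poly (q e) x" by metis
  then show ?case
    by (intro exI[of _ "max n m"] exI[of _ "\<lambda>e. p e - q e"]) (simp add: parpoly_diff del: fun_upd_apply)
next
  case (mult f g)
  then obtain n p m q where "p \<in> parpoly i n" "q \<in> parpoly i m"
    "\<forall>e x. f (e(i := x)) = poly (p e) x" "\<forall>e x. g (e(i := x)) = poly (q e) x" by metis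
  then show ?case
    by (intro exI[of _ "n + m"] exI[of _ "\<lambda>e. p e * q e"]) (simp add: parpoly_mult del: fun_upd_apply)
qed

lemma definable_parpoly_eq_0:
  assumes "p \<in> parpoly i n"
  shows "(\<lambda>e. p e = 0) \<in> definable"
proof -
  have "p e = 0 \<longleftrightarrow> (\<forall>j\<in>{..<n}. coeff (p e) j = 0)" for e
    using parpolyD(3)[OF assms] by (metis lessThan_iff not_less poly_eqI coeff_0)
  then show ?thesis
    using definable_ball[of "{..<n}" "\<lambda>j e. coeff (p e) j = 0"] assms
    by (simp add: parpolyD(1) definable.zero)
qed

lemma parpoly_reduce:
  fixes p q :: "('v \<Rightarrow> 'a::comm_ring_1) \<Rightarrow> 'a poly"
  assumes "p \<in> parpoly i (Suc n)" "q \<in> parpoly i (Suc m)" "n \<le> m"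
  shows "(\<lambda>e. smult (coeff (p e) n) (q e) - monom (coeff (q e) m) (m - n) * p e) \<in> parpoly i m"
    (is "?r \<in> _")
proof -
  have "?r \<in> parpoly i (max (Suc m) (Suc (m - n) + Suc n))"
    by (intro parpoly_diff parpoly_mult parpoly_smult parpoly_monom) (use assms in auto)
  then have r: "?r \<in> parpoly i (Suc (Suc m))" using assms(3) by simp
  have "coeff (?r e) j = 0" if "m \<le> j" for e j
  proof (cases "m = j")
    case True
    then show ?thesis using assms(3) by (simp add: coeff_monom_mult)
  next
    case False
    then have "Suc m \<le> j" "Suc n \<le> j - (m - n)" using that assms(3) by auto
    then show ?thesis
      using parpolyD(3)[OF assms(1)] parpolyD(3)[OF assms(2)] by (simp add: coeff_monom_mult)
  qed
  then show ?thesis by (rule parpoly_shrink[OF r])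
qed

lemma parpoly_truncate:
  assumes "p \<in> parpoly i (Suc n)"
  shows "(\<lambda>e. p e - monom (coeff (p e) n) n) \<in> parpoly i n" (is "?r \<in> _")
proof -
  have r: "?r \<in> parpoly i (max (Suc n) (Suc n))"
    by (intro parpoly_diff parpoly_monom) (use assms in auto)
  have "coeff (?r e) j = 0" if "n \<le> j" for e j
  proof (cases "n = j")
    case False
    then have "coeff (p e) j = 0" using that by (intro parpolyD(3)[OF assms]) simp
    then show ?thesis using False by simp
  qed simp
  then show ?thesis by (rule parpoly_shrink[OF r])
qed

lemma definable_parpoly_dvd:
  fixes p g :: "('v \<Rightarrow> 'a::field) \<Rightarrow> 'a poly"
  assumes p: "p \<in> parpoly i (Suc n)" and "g \<in> parpoly i m"
  shows "(\<lambda>e. coeff (p e) n \<noteq> 0 \<and> p e dvd g e) \<in> definable"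
  using assms(2)
proof (induction m arbitrary: g)
  case 0
  then have "g e = 0" for e by (auto simp: parpoly_def intro: poly_eqI)
  then show ?case using definable.neg[OF definable.zero[OF parpolyD(1)[OF p]]] by simp
next
  case (Suc m)
  show ?case
  proof (cases "n \<le> m")
    case False
    have "(coeff (p e) n \<noteq> 0 \<and> p e dvd g e) \<longleftrightarrow> (coeff (p e) n \<noteq> 0 \<and> g e = 0)" for e
    proof (cases "coeff (p e) n = 0")
      case c: False
      have "p e dvd g e \<Longrightarrow> g e = 0"
        using parpoly_degree[OF Suc.prems, of e] False le_degree[OF c]
        by (metis dvd_imp_degree_le le_trans not_less not_less_eq)
      then show ?thesis by auto
    qed auto
    moreover have "(\<lambda>e. coeff (p e) n \<noteq> 0 \<and> g e = 0) \<in> definable"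
      by (intro definable.conj definable.neg definable.zero parpolyD(1)[OF p]
            definable_parpoly_eq_0[OF Suc.prems])
    ultimately show ?thesis by simp
  next
    case True
    let ?r = "\<lambda>e. smult (coeff (p e) n) (g e) - monom (coeff (g e) m) (m - n) * p e"
    have "(coeff (p e) n \<noteq> 0 \<and> p e dvd g e) \<longleftrightarrow> (coeff (p e) n \<noteq> 0 \<and> p e dvd ?r e)" for e
    proof (rule conj_cong[OF refl])
      assume c: "coeff (p e) n \<noteq> 0"
      have "p e dvd ?r e \<longleftrightarrow> p e dvd smult (coeff (p e) n) (g e)"
        by (rule dvd_diff_left_iff) simp
      then show "p e dvd g e \<longleftrightarrow> p e dvd ?r e" using c by (simp add: dvd_smult_iff)
    qed
    then show ?thesis using Suc.IH[OF parpoly_reduce[OF p Suc.prems True]] by simp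
  qed
qed

lemma dvd_power_iff_roots:
  fixes p g :: "'a::alg_closed_field poly"
  assumes "p \<noteq> 0" "degree p \<le> n"
  shows "p dvd g ^ n \<longleftrightarrow> (\<forall>x. poly p x = 0 \<longrightarrow> poly g x = 0)"
proof
  assume d: "p dvd g ^ n"
  show "\<forall>x. poly p x = 0 \<longrightarrow> poly g x = 0"
  proof (intro allI impI)
    fix x assume "poly p x = 0"
    then have "poly (g ^ n) x = 0" using d by (metis dvdE mult_zero_left poly_mult)
    then show "poly g x = 0" by (simp add: poly_power)
  qed
next
  assume "\<forall>x. poly p x = 0 \<longrightarrow> poly g x = 0"
  then show "p dvd g ^ n" using assms
  proof (induction "degree p" arbitrary: p n)
    case 0
    then have "is_unit p" by (simp add: is_unit_iff_degree)
    then show ?case by (rule unit_imp_dvd)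
  next
    case (Suc l)
    then obtain x where x: "poly p x = 0" using alg_closed_imp_poly_has_root[of p] by auto
    then obtain q where q: "p = [:-x, 1:] * q" by (metis dvdE poly_eq_0_iff_dvd)
    have "q \<noteq> 0" using q Suc.prems by auto
    have "degree p = 1 + degree q" unfolding q using \<open>q \<noteq> 0\<close> by (subst degree_mult_eq) auto
    then have deg: "l = degree q" using Suc.hyps by simp
    then obtain m where m: "n = Suc m" using Suc by (cases n) auto
    have "q dvd g ^ m"
    proof (rule Suc.hyps(1)[OF deg])
      show "\<forall>x. poly q x = 0 \<longrightarrow> poly g x = 0" using Suc.prems(1) q by auto
      show "degree q \<le> m" using Suc.prems(3) m deg Suc.hyps(2) by simp
    qed (use \<open>q \<noteq> 0\<close> in auto)
    moreover have "[:-x, 1:] dvd g" using x Suc.prems(1) poly_eq_0_iff_dvd by blast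
    ultimately show ?case unfolding q m power_Suc by (rule mult_dvd_mono[rotated])
  qed
qed

lemma infinite_UNIV_alg_closed: "infinite (UNIV :: 'a::alg_closed_field set)"
proof
  assume fin: "finite (UNIV :: 'a set)"
  let ?p = "(\<Prod>a\<in>UNIV. [:- a, 1:]) + 1 :: 'a poly"
  have one: "poly ?p x = 1" for x
    using fin by (simp add: poly_prod)
  have "degree (\<Prod>a\<in>(UNIV :: 'a set). [:- a, 1:]) = card (UNIV :: 'a set)"
    by (subst degree_prod_eq_sum_degree) auto
  moreover have "card (UNIV :: 'a set) > 0" using fin by (simp add: card_gt_0_iff)
  ultimately have "degree ?p > 0" by (subst degree_add_eq_left) auto
  then show False using alg_closed_imp_poly_has_root one by (metis zero_neq_one)
qed

lemma poly_eq_0_iff_all: "p = 0 \<longleftrightarrow> (\<forall>x. poly p x = 0)" for p :: "'a::alg_closed_field poly"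
  using infinite_UNIV_alg_closed[where 'a = 'a] poly_roots_finite[of p]
  by (cases "\<forall>x. poly p x = 0") auto

lemma definable_ex_system:
  fixes g :: "('v \<Rightarrow> 'a::alg_closed_field) \<Rightarrow> 'a poly"
  assumes "\<And>n p. (n, p) \<in> set ps \<Longrightarrow> p \<in> parpoly i n" "g \<in> parpoly i m"
  shows "(\<lambda>e. \<exists>x. (\<forall>(n, p) \<in> set ps. poly (p e) x = 0) \<and> poly (g e) x \<noteq> 0) \<in> definable"
  using assms(1)
proof (induction "\<Sum>(n, p) \<leftarrow> ps. Suc n" arbitrary: ps rule: less_induct)
  case less
  let ?E = "\<lambda>ps e. \<exists>x. (\<forall>(n, p) \<in> set ps. poly (p e) x = 0) \<and> poly (g e) x \<noteq> 0"
  have trunc: "(\<lambda>e. coeff (p e) n = 0 \<and> ?E ((Suc n, p) # qs) e) \<in> definable"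
    if "(\<Sum>(n, p) \<leftarrow> ps. Suc n) = (\<Sum>(n, p) \<leftarrow> (Suc n, p) # qs. Suc n)"
      "\<And>m q. (m, q) \<in> set ((Suc n, p) # qs) \<Longrightarrow> q \<in> parpoly i m" for n p qs
  proof -
    let ?r = "\<lambda>e. p e - monom (coeff (p e) n) n"
    have p: "p \<in> parpoly i (Suc n)" using that(2) by simp
    have "?E ((n, ?r) # qs) \<in> definable"
    proof (rule less.hyps)
      fix m q assume "(m, q) \<in> set ((n, ?r) # qs)"
      then show "q \<in> parpoly i m" using parpoly_truncate[OF p] that(2) by auto
    qed (use that(1) in simp)
    then have "(\<lambda>e. coeff (p e) n = 0 \<and> ?E ((n, ?r) # qs) e) \<in> definable"
      by (intro definable.conj definable.zero parpolyD(1)[OF p])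
    also have "(\<lambda>e. coeff (p e) n = 0 \<and> ?E ((n, ?r) # qs) e)
      = (\<lambda>e. coeff (p e) n = 0 \<and> ?E ((Suc n, p) # qs) e)"
      by (intro ext conj_cong refl) simp
    finally show ?thesis .
  qed
  have zero: "?E ((0, p) # qs) \<in> definable"
    if "(\<Sum>(n, p) \<leftarrow> ps. Suc n) = (\<Sum>(n, p) \<leftarrow> (0, p) # qs. Suc n)"
      "\<And>m q. (m, q) \<in> set ((0, p) # qs) \<Longrightarrow> q \<in> parpoly i m" for p qs
  proof -
    have "p e = 0" for e using that(2)[of 0 p] by (auto simp: parpoly_def intro: poly_eqI)
    moreover have "?E qs \<in> definable"
      by (rule less.hyps) (use that in auto)
    ultimately show ?thesis by simp
  qed
  have two: "?E ((n, p) # (m, q) # qs) \<in> definable"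
    if "n \<le> m" "(\<Sum>(n, p) \<leftarrow> ps. Suc n) = (\<Sum>(n, p) \<leftarrow> (n, p) # (m, q) # qs. Suc n)"
      "\<And>m' q'. (m', q') \<in> set ((n, p) # (m, q) # qs) \<Longrightarrow> q' \<in> parpoly i m'" for n p m q qs
  proof (cases n)
    case 0
    then show ?thesis using zero that(2,3) by blast
  next
    case n: (Suc n')
    then obtain m' where m: "m = Suc m'" using \<open>n \<le> m\<close> by (cases m) auto
    have p: "p \<in> parpoly i (Suc n')" and q: "q \<in> parpoly i (Suc m')" using that(3) n m by auto
    let ?r = "\<lambda>e. smult (coeff (p e) n') (q e) - monom (coeff (q e) m') (m' - n') * p e"
    have r: "?r \<in> parpoly i m'" using parpoly_reduce[OF p q] that(1) n m by simp
    have "?E ((n, p) # (m', ?r) # qs) \<in> definable"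
    proof (rule less.hyps)
      fix l q' assume "(l, q') \<in> set ((n, p) # (m', ?r) # qs)"
      then show "q' \<in> parpoly i l" using r that(3) by auto
    qed (use that(2) m in simp)
    then have "(\<lambda>e. coeff (p e) n' \<noteq> 0 \<and> ?E ((n, p) # (m', ?r) # qs) e) \<in> definable"
      by (intro definable.conj definable.neg definable.zero parpolyD(1)[OF p])
    also have "(\<lambda>e. coeff (p e) n' \<noteq> 0 \<and> ?E ((n, p) # (m', ?r) # qs) e)
      = (\<lambda>e. coeff (p e) n' \<noteq> 0 \<and> ?E ((n, p) # (m, q) # qs) e)"
      by (intro ext conj_cong refl arg_cong[where f = Ex]) auto
    finally have "(\<lambda>e. coeff (p e) n' \<noteq> 0 \<and> ?E ((n, p) # (m, q) # qs) e) \<in> definable" .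
    moreover have "(\<lambda>e. coeff (p e) n' = 0 \<and> ?E ((n, p) # (m, q) # qs) e) \<in> definable"
      using trunc[of n' p "(m, q) # qs"] that(2,3) n by blast
    ultimately have "(\<lambda>e. (coeff (p e) n' \<noteq> 0 \<and> ?E ((n, p) # (m, q) # qs) e)
       \<or> (coeff (p e) n' = 0 \<and> ?E ((n, p) # (m, q) # qs) e)) \<in> definable"
      by (rule definable_disj)
    also have "(\<lambda>e. (coeff (p e) n' \<noteq> 0 \<and> ?E ((n, p) # (m, q) # qs) e)
       \<or> (coeff (p e) n' = 0 \<and> ?E ((n, p) # (m, q) # qs) e)) = ?E ((n, p) # (m, q) # qs)"
      by (intro ext) argo
    finally show ?thesis .
  qed
  consider "ps = []" | n p where "ps = [(n, p)]" | n p m q qs where "ps = (n, p) # (m, q) # qs"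
    by (metis list.exhaust surj_pair)
  then show ?case
  proof cases
    case 1
    have "(\<lambda>e. \<not> g e = 0) \<in> definable"
      by (intro definable.neg definable_parpoly_eq_0[OF assms(2)])
    then show ?thesis using 1 by (simp add: poly_eq_0_iff_all[of "g _"])
  next
    case 2
    show ?thesis
    proof (cases n)
      case 0
      then show ?thesis using zero[of p "[]"] 2 less.prems by simp
    next
      case n: (Suc n')
      have p: "p \<in> parpoly i (Suc n')" using 2 less.prems n by simp
      obtain l where l: "(\<lambda>e. g e ^ n') \<in> parpoly i l" using parpoly_power[OF assms(2)] by blast
      have "(\<lambda>e. coeff (p e) n' \<noteq> 0 \<and> \<not> (coeff (p e) n' \<noteq> 0 \<and> p e dvd g e ^ n')) \<in> definable"
        by (intro definable.conj definable.neg definable.zero parpolyD(1)[OF p]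
            definable_parpoly_dvd[OF p l, unfolded conj_absorb])
      moreover have "coeff (p e) n' \<noteq> 0 \<and> \<not> (coeff (p e) n' \<noteq> 0 \<and> p e dvd g e ^ n')
        \<longleftrightarrow> coeff (p e) n' \<noteq> 0 \<and> ?E ps e" for e
      proof (cases "coeff (p e) n' = 0")
        case False
        then have "p e \<noteq> 0" by auto
        moreover have "degree (p e) \<le> n'" using parpoly_degree[OF p calculation] by simp
        ultimately show ?thesis using dvd_power_iff_roots[of "p e" n' "g e"] 2 by auto
      qed auto
      ultimately have "(\<lambda>e. coeff (p e) n' \<noteq> 0 \<and> ?E ps e) \<in> definable" by simp
      moreover have "(\<lambda>e. coeff (p e) n' = 0 \<and> ?E ps e) \<in> definable"
        using trunc[of n' p "[]"] 2 n less.prems by simp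
      ultimately have "(\<lambda>e. (coeff (p e) n' \<noteq> 0 \<and> ?E ps e) \<or> (coeff (p e) n' = 0 \<and> ?E ps e))
          \<in> definable"
        by (rule definable_disj)
      also have "(\<lambda>e. (coeff (p e) n' \<noteq> 0 \<and> ?E ps e) \<or> (coeff (p e) n' = 0 \<and> ?E ps e)) = ?E ps"
        by (intro ext) argo
      finally show ?thesis .
    qed
  next
    case 3
    show ?thesis
    proof (cases "n \<le> m")
      case True
      then show ?thesis using two[of n m p q qs] 3 less.prems by blast
    next
      case False
      have "?E ((m, q) # (n, p) # qs) \<in> definable"
        by (rule two) (use False 3 less.prems in auto)
      moreover have "set ((m, q) # (n, p) # qs) = set ps" using 3 by auto
      ultimately show ?thesis by (simp only:)
    qed
  qed
qed

text \<open>The inequations of each disjunct are multiplied into a single one.\<close>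

lemma definable_dnf:
  fixes P :: "('v \<Rightarrow> 'a::idom) \<Rightarrow> bool"
  assumes "P \<in> definable"
  shows "\<exists>D. set D \<subseteq> lists polyfun \<times> polyfun
    \<and> (\<forall>e. P e \<longleftrightarrow> (\<exists>(fs, g) \<in> set D. (\<forall>f\<in>set fs. f e = 0) \<and> g e \<noteq> 0))" (is "?dnf P")
proof -
  have conj: "?dnf (\<lambda>e. P e \<and> Q e)" if dP: "?dnf P" and dQ: "?dnf Q"
    for P Q :: "('v \<Rightarrow> 'a) \<Rightarrow> bool"
  proof -
    from dP obtain D where D: "set D \<subseteq> lists polyfun \<times> polyfun"
      "\<forall>e. P e \<longleftrightarrow> (\<exists>(fs, g) \<in> set D. (\<forall>f\<in>set fs. f e = 0) \<and> g e \<noteq> 0)"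
      by (elim exE conjE)
    from dQ obtain D' where D': "set D' \<subseteq> lists polyfun \<times> polyfun"
      "\<forall>e. Q e \<longleftrightarrow> (\<exists>(fs, g) \<in> set D'. (\<forall>f\<in>set fs. f e = 0) \<and> g e \<noteq> 0)"
      by (elim exE conjE)
    let ?D = "map (\<lambda>((fs, g), (fs', g')). (fs @ fs', \<lambda>e. g e * g' e)) (List.product D D')"
    have "set ?D \<subseteq> lists polyfun \<times> polyfun"
    proof
      fix y assume "y \<in> set ?D"
      then obtain fs g fs' g' where y: "y = (fs @ fs', \<lambda>e. g e * g' e)"
        "(fs, g) \<in> set D" "(fs', g') \<in> set D'" by auto
      then have "(fs, g) \<in> lists polyfun \<times> polyfun" "(fs', g') \<in> lists polyfun \<times> polyfun"
        using D(1) D'(1) by blast+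
      then show "y \<in> lists polyfun \<times> polyfun" using y(1) by (simp add: polyfun.mult)
    qed
    moreover have "P e \<and> Q e \<longleftrightarrow> (\<exists>(fs, g) \<in> set ?D. (\<forall>f\<in>set fs. f e = 0) \<and> g e \<noteq> 0)" for e
    proof
      assume "P e \<and> Q e"
      then obtain fs g fs' g' where "(fs, g) \<in> set D" "(fs', g') \<in> set D'"
        and z: "\<forall>f\<in>set fs. f e = 0" "g e \<noteq> 0" "\<forall>f\<in>set fs'. f e = 0" "g' e \<noteq> 0"
        unfolding D(2)[rule_format] D'(2)[rule_format] by blast
      then have "((fs, g), (fs', g')) \<in> set (List.product D D')" by simp
      then have "(fs @ fs', \<lambda>e. g e * g' e) \<in> set ?D" unfolding set_map by (rule rev_image_eqI) simp
      then show "\<exists>(fs, g) \<in> set ?D. (\<forall>f\<in>set fs. f e = 0) \<and> g e \<noteq> 0"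
        by (rule rev_bexI) (use z in auto)
    next
      assume "\<exists>(fs, g) \<in> set ?D. (\<forall>f\<in>set fs. f e = 0) \<and> g e \<noteq> 0"
      then obtain fs g fs' g' where "(fs, g) \<in> set D" "(fs', g') \<in> set D'"
        "\<forall>f\<in>set (fs @ fs'). f e = 0" "g e * g' e \<noteq> 0" by auto
      then show "P e \<and> Q e" unfolding D(2)[rule_format] D'(2)[rule_format]
        by (intro conjI bexI[of _ "(fs, g)"] bexI[of _ "(fs', g')"]) auto
    qed
    ultimately show ?thesis by (intro exI[of _ ?D]) blast
  qed
  have disj: "?dnf (\<lambda>e. P e \<or> Q e)" if dP: "?dnf P" and dQ: "?dnf Q"
    for P Q :: "('v \<Rightarrow> 'a) \<Rightarrow> bool"
  proof -
    from dP obtain D where D: "set D \<subseteq> lists polyfun \<times> polyfun"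
      "\<forall>e. P e \<longleftrightarrow> (\<exists>(fs, g) \<in> set D. (\<forall>f\<in>set fs. f e = 0) \<and> g e \<noteq> 0)"
      by (elim exE conjE)
    from dQ obtain D' where D': "set D' \<subseteq> lists polyfun \<times> polyfun"
      "\<forall>e. Q e \<longleftrightarrow> (\<exists>(fs, g) \<in> set D'. (\<forall>f\<in>set fs. f e = 0) \<and> g e \<noteq> 0)"
      by (elim exE conjE)
    show ?thesis
      by (intro exI[of _ "D @ D'"]) (use D D' in \<open>auto simp: bex_Un\<close>)
  qed
  have "?dnf P \<and> ?dnf (\<lambda>e. \<not> P e)"
    using assms
  proof induction
    case (zero f)
    have "?dnf (\<lambda>e. f e = 0)"
      by (intro exI[of _ "[([f], \<lambda>_. 1)]"]) (use zero in \<open>auto intro: polyfun.one\<close>)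
    moreover have "?dnf (\<lambda>e. f e \<noteq> 0)"
      by (intro exI[of _ "[([], f)]"]) (use zero in auto)
    ultimately show ?case by blast
  next
    case (neg P)
    then show ?case by simp
  next
    case (conj P Q)
    then show ?case using \<open>\<And>Q P. ?dnf P \<Longrightarrow> ?dnf Q \<Longrightarrow> ?dnf (\<lambda>e. P e \<and> Q e)\<close>
       disj[of "\<lambda>e. \<not> P e" "\<lambda>e. \<not> Q e"] by (simp only: de_Morgan_conj)
  qed
  then show ?thesis by blast
qed

theorem definable_ex:
  fixes P :: "('v \<Rightarrow> 'a::alg_closed_field) \<Rightarrow> bool"
  assumes "P \<in> definable"
  shows "(\<lambda>e. \<exists>x. P (e(i := x))) \<in> definable"
proof -
  from definable_dnf[OF assms] obtain D where D: "set D \<subseteq> lists polyfun \<times> polyfun"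
    "\<forall>e. P e \<longleftrightarrow> (\<exists>(fs, g) \<in> set D. (\<forall>f\<in>set fs. f e = 0) \<and> g e \<noteq> 0)"
    by (elim exE conjE)
  have "(\<lambda>e. \<exists>x. (\<forall>f\<in>set fs. f (e(i := x)) = 0) \<and> g (e(i := x)) \<noteq> 0) \<in> definable"
    if "(fs, g) \<in> set D" for fs g
  proof -
    have fs: "set fs \<subseteq> polyfun" and g: "g \<in> polyfun" using D(1) that by (auto simp: lists_eq_set)
    obtain m q where q: "q \<in> parpoly i m" "\<And>e x. g (e(i := x)) = poly (q e) x"
      using polyfun_parpoly[OF g] by metis
    have "\<exists>np. snd np \<in> parpoly i (fst np) \<and> (\<forall>e x. f (e(i := x)) = poly (snd np e) x)"
      if f: "f \<in> set fs" for f
    proof -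
      obtain n p where "p \<in> parpoly i n" "\<forall>e x. f (e(i := x)) = poly (p e) x"
        using polyfun_parpoly[of f i] fs f by blast
      then show ?thesis by (intro exI[of _ "(n, p)"]) simp
    qed
    then obtain np where np: "\<And>f. f \<in> set fs \<Longrightarrow> snd (np f) \<in> parpoly i (fst (np f))
        \<and> (\<forall>e x. f (e(i := x)) = poly (snd (np f) e) x)" by metis
    define N p where "N f = fst (np f)" and "p f = snd (np f)" for f
    have p: "p f \<in> parpoly i (N f)" "f (e(i := x)) = poly (p f e) x" if "f \<in> set fs" for f e x
      using np[OF that] unfolding N_def p_def by auto
    let ?ps = "map (\<lambda>f. (N f, p f)) fs"
    have "(\<lambda>e. \<exists>x. (\<forall>(n, p) \<in> set ?ps. poly (p e) x = 0) \<and> poly (q e) x \<noteq> 0) \<in> definable"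
      by (rule definable_ex_system) (use p(1) q(1) in auto)
    then show ?thesis by (simp add: p(2) q(2) cong: ball_cong)
  qed
  then have "(\<lambda>e. \<exists>(fs, g) \<in> set D. \<exists>x. (\<forall>f\<in>set fs. f (e(i := x)) = 0) \<and> g (e(i := x)) \<noteq> 0)
      \<in> definable"
    using definable_bex[of "set D" "\<lambda>(fs, g) e. \<exists>x. (\<forall>f\<in>set fs. f (e(i := x)) = 0) \<and> g (e(i := x)) \<noteq> 0"]
    by (auto simp: case_prod_unfold)
  moreover have "(\<exists>x. P (e(i := x))) \<longleftrightarrow> (\<exists>(fs, g) \<in> set D. \<exists>x. (\<forall>f\<in>set fs. f (e(i := x)) = 0) \<and> g (e(i := x)) \<noteq> 0)"
    for e unfolding D(2)[rule_format] by auto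
  ultimately show ?thesis by simp
qed

section \<open>Dimension and algebraic closure\<close>

lemma polyfun_fibre:
  fixes f :: "('v \<Rightarrow> 'a::alg_closed_field) \<Rightarrow> 'a"
  assumes "f \<in> polyfun"
  shows "\<exists>n. \<forall>e. (\<forall>x. f (e(i := x)) = 0)
    \<or> finite {x. f (e(i := x)) = 0} \<and> card {x. f (e(i := x)) = 0} \<le> n"
proof -
  obtain n p where p: "p \<in> parpoly i n" "\<And>e x. f (e(i := x)) = poly (p e) x"
    using polyfun_parpoly[OF assms] by metis
  have "(\<forall>x. f (e(i := x)) = 0)
    \<or> finite {x. f (e(i := x)) = 0} \<and> card {x. f (e(i := x)) = 0} \<le> n" for e
  proof (cases "p e = 0")
    case True
    then show ?thesis by (simp add: p(2) del: fun_upd_apply)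
  next
    case False
    then show ?thesis using parpoly_degree[OF p(1) False] card_poly_roots_bound[OF False]
        poly_roots_finite[OF False] by (simp add: p(2) del: fun_upd_apply)
  qed
  then show ?thesis by blast
qed

lemma MOST_polyfun_eq_0:
  fixes f :: "('v \<Rightarrow> 'a::alg_closed_field) \<Rightarrow> 'a"
  assumes "f \<in> polyfun"
  shows "(MOST x. f (e(i := x)) = 0) \<longleftrightarrow> (\<forall>x. f (e(i := x)) = 0)"
    and "(MOST x. f (e(i := x)) \<noteq> 0) \<longleftrightarrow> \<not> (\<forall>x. f (e(i := x)) = 0)"
proof -
  obtain n where "\<forall>e. (\<forall>x. f (e(i := x)) = 0) \<or> finite {x. f (e(i := x)) = 0}
      \<and> card {x. f (e(i := x)) = 0} \<le> n"
    using polyfun_fibre[OF assms] by blast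
  then consider "\<forall>x. f (e(i := x)) = 0" | "finite {x. f (e(i := x)) = 0}" "\<not> (\<forall>x. f (e(i := x)) = 0)"
    by blast
  note c = this
  have inf: "infinite (UNIV :: 'a set)" by (rule infinite_UNIV_alg_closed)
  have *: "UNIV = {x. f (e(i := x)) = 0} \<union> {x. f (e(i := x)) \<noteq> 0}" by blast
  show "(MOST x. f (e(i := x)) = 0) \<longleftrightarrow> (\<forall>x. f (e(i := x)) = 0)"
    using c
  proof cases
    case 2
    then have "infinite {x. f (e(i := x)) \<noteq> 0}" using inf * by (metis finite_Un)
    then show ?thesis using 2 by (simp add: eventually_cofinite del: fun_upd_apply)
  qed (simp add: eventually_cofinite)
  show "(MOST x. f (e(i := x)) \<noteq> 0) \<longleftrightarrow> \<not> (\<forall>x. f (e(i := x)) = 0)"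
    using c
  proof cases
    case 1
    then show ?thesis using inf by (simp add: eventually_cofinite del: fun_upd_apply)
  next
    case 2
    then show ?thesis by (simp add: eventually_cofinite del: fun_upd_apply)
  qed
qed

lemma MOST_definable_not:
  fixes P :: "('v \<Rightarrow> 'a::alg_closed_field) \<Rightarrow> bool"
  assumes "P \<in> definable"
  shows "(MOST x. \<not> P (e(i := x))) \<longleftrightarrow> \<not> (MOST x. P (e(i := x)))"
  using assms
proof induction
  case (zero f)
  then show ?case by (simp add: MOST_polyfun_eq_0 del: fun_upd_apply)
next
  case (neg P)
  then show ?case by simp
next
  case (conj P Q)
  have inf: "infinite (UNIV :: 'a set)" by (rule infinite_UNIV_alg_closed)
  show ?case
  proof
    assume "MOST x. \<not> (P (e(i := x)) \<and> Q (e(i := x)))"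
    then show "\<not> (MOST x. P (e(i := x)) \<and> Q (e(i := x)))"
      using eventually_conj[of "\<lambda>x. \<not> (P (e(i := x)) \<and> Q (e(i := x)))" cofinite
          "\<lambda>x. P (e(i := x)) \<and> Q (e(i := x))"] inf
      by (auto simp: eventually_cofinite simp del: fun_upd_apply)
  next
    assume "\<not> (MOST x. P (e(i := x)) \<and> Q (e(i := x)))"
    then have "\<not> (MOST x. P (e(i := x))) \<or> \<not> (MOST x. Q (e(i := x)))"
      unfolding eventually_conj_iff by blast
    then have "(MOST x. \<not> P (e(i := x))) \<or> (MOST x. \<not> Q (e(i := x)))"
      using conj.IH by blast
    then show "MOST x. \<not> (P (e(i := x)) \<and> Q (e(i := x)))"
      by (auto elim: eventually_mono)
  qed
qed

lemma definable_MOST: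
  fixes P :: "('v \<Rightarrow> 'a::alg_closed_field) \<Rightarrow> bool"
  assumes "P \<in> definable"
  shows "(\<lambda>e. MOST x. P (e(i := x))) \<in> definable"
  using assms
proof induction
  case (zero f)
  have "(\<lambda>e. \<not> (\<exists>x. \<not> f (e(i := x)) = 0)) \<in> definable"
    by (intro definable.neg definable_ex[where P = "\<lambda>e. \<not> f e = 0"] definable.zero zero)
  then show ?case by (simp add: MOST_polyfun_eq_0[OF zero] del: fun_upd_apply)
next
  case (neg P)
  show ?case unfolding MOST_definable_not[OF neg.hyps] by (rule definable.neg[OF neg.IH])
next
  case (conj P Q)
  then show ?case by (simp add: eventually_conj_iff definable.conj del: fun_upd_apply)
qed

lemma definable_fibre_bound:
  fixes P :: "('v \<Rightarrow> 'a::alg_closed_field) \<Rightarrow> bool"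
  assumes "P \<in> definable"
  shows "\<exists>N. \<forall>e. \<not> (MOST x. P (e(i := x))) \<longrightarrow>
    finite {x. P (e(i := x))} \<and> card {x. P (e(i := x))} \<le> N"
proof -
  define small where "small N A \<longleftrightarrow> finite A \<and> card A \<le> N" for N and A :: "'a set"
  have smallUn: "small (N + M) (A \<union> B)" if "small N A" "small M B" for N M A B
    using that card_Un_le[of A B] by (auto simp: small_def)
  have smallsub: "small M B" if "small N A" "B \<subseteq> A" "N \<le> M" for N M A B
    using that card_mono[of A B] finite_subset[of B A] by (auto simp: small_def)
  have "\<exists>N. \<forall>e. small N {x. P (e(i := x))} \<or> small N {x. \<not> P (e(i := x))}"
    using assms
  proof induction
    case (zero f)
    then obtain n where n: "\<forall>e. (\<forall>x. f (e(i := x)) = 0) \<or> finite {x. f (e(i := x)) = 0}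
      \<and> card {x. f (e(i := x)) = 0} \<le> n"
      using polyfun_fibre[OF zero, of i] by (elim exE)
    show ?case
    proof (intro exI[of _ n] allI)
      fix e
      from n have "(\<forall>x. f (e(i := x)) = 0) \<or> finite {x. f (e(i := x)) = 0}
        \<and> card {x. f (e(i := x)) = 0} \<le> n" by blast
      then show "small n {x. f (e(i := x)) = 0} \<or> small n {x. f (e(i := x)) \<noteq> 0}"
      proof
        assume "\<forall>x. f (e(i := x)) = 0"
        then have "{x. f (e(i := x)) \<noteq> 0} = {}" by blast
        then show ?thesis by (simp add: small_def)
      qed (simp add: small_def)
    qed
  next
    case (neg P)
    then show ?case by (simp del: fun_upd_apply add: disj_commute)
  next
    case (conj P Q)
    then obtain N M where NM: "\<And>e. small N {x. P (e(i := x))} \<or> small N {x. \<not> P (e(i := x))}"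
      "\<And>e. small M {x. Q (e(i := x))} \<or> small M {x. \<not> Q (e(i := x))}" by blast
    show ?case
    proof (intro exI[of _ "N + M"] allI)
      fix e
      have "{x. P (e(i := x)) \<and> Q (e(i := x))} \<subseteq> {x. P (e(i := x))}"
        "{x. P (e(i := x)) \<and> Q (e(i := x))} \<subseteq> {x. Q (e(i := x))}"
        "{x. \<not> (P (e(i := x)) \<and> Q (e(i := x)))} = {x. \<not> P (e(i := x))} \<union> {x. \<not> Q (e(i := x))}"
        by blast+
      then show "small (N + M) {x. P (e(i := x)) \<and> Q (e(i := x))} \<or>
        small (N + M) {x. \<not> (P (e(i := x)) \<and> Q (e(i := x)))}"
        using NM[of e] smallsub smallUn by (metis le_add1 le_add2)
    qed
  qed
  then obtain N where "\<forall>e. small N {x. P (e(i := x))} \<or> small N {x. \<not> P (e(i := x))}" by blast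
  then show ?thesis unfolding small_def eventually_cofinite by blast
qed

lemma MOST_commute:
  fixes P :: "('v \<Rightarrow> 'a::alg_closed_field) \<Rightarrow> bool"
  assumes "P \<in> definable" "i \<noteq> j"
  shows "(MOST x. MOST y. P (e(i := x, j := y))) \<longleftrightarrow> (MOST y. MOST x. P (e(i := x, j := y)))"
proof -
  have tw: "e(i := x, j := y) = e(j := y, i := x)" for x y
    using assms(2) by (rule fun_upd_twist)
  show ?thesis
    using assms(1)
  proof induction
    case (zero f)
    have "(MOST x. MOST y. f (e(i := x, j := y)) = 0) \<longleftrightarrow> (\<forall>x y. f (e(i := x, j := y)) = 0)"
      for e i j
    proof
      assume "MOST x. MOST y. f (e(i := x, j := y)) = 0"
      then have "MOST x. \<forall>y. f (e(i := x, j := y)) = 0"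
        by (simp add: MOST_polyfun_eq_0[OF zero] del: fun_upd_apply)
      then have "MOST x. f (e(i := x, j := y)) = 0" for y
        by (rule eventually_mono) blast
      moreover have "e(i := x, j := y) = (if i = j then e(j := y) else e(j := y, i := x))" for x y
        by auto
      ultimately show "\<forall>x y. f (e(i := x, j := y)) = 0"
        using MOST_polyfun_eq_0(1)[OF zero]
        by (cases "i = j") (simp_all add: eventually_const_iff infinite_UNIV_alg_closed del: fun_upd_apply)
    qed (simp add: eventually_cofinite)
    from this[of e i j] this[of e j i] show ?case by (auto simp: tw simp del: fun_upd_apply)
  next
    case (neg P)
    have "(MOST x. MOST y. \<not> P (e(i := x, j := y))) \<longleftrightarrow> \<not> (MOST x. MOST y. P (e(i := x, j := y)))"
      using MOST_definable_not[OF definable_MOST[OF neg.hyps], where i = i]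
      by (simp add: MOST_definable_not[OF neg.hyps] del: fun_upd_apply)
    moreover have "(MOST y. MOST x. \<not> P (e(i := x, j := y))) \<longleftrightarrow> \<not> (MOST y. MOST x. P (e(i := x, j := y)))"
      using MOST_definable_not[OF definable_MOST[OF neg.hyps], where i = j]
      by (simp add: MOST_definable_not[OF neg.hyps] tw del: fun_upd_apply)
    ultimately show ?case using neg.IH by blast
  next
    case (conj P Q)
    then show ?case by (simp add: eventually_conj_iff del: fun_upd_apply)
  qed
qed

lemma polyfun_rename:
  assumes "f \<in> polyfun"
  shows "(\<lambda>e. f (\<lambda>v. e (r v))) \<in> polyfun"
  using assms by induction (auto intro: polyfun.intros)

text \<open>Algebraic closure over the field generated by \<open>S\<close>. Allowing the parameter 0 makes the
  values of variables that do not occur in \<open>f\<close> irrelevant even when \<open>S\<close> is empty.\<close>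

definition acl :: "'a::alg_closed_field set \<Rightarrow> 'a set" where
  "acl S = {x. \<exists>f \<in> polyfun. \<exists>(e :: nat \<Rightarrow> 'a) i. (\<forall>j. j \<noteq> i \<longrightarrow> e j \<in> insert 0 S)
     \<and> f (e(i := x)) = 0 \<and> \<not> (\<forall>z. f (e(i := z)) = 0)}"

lemma acl_mono: "S \<subseteq> T \<Longrightarrow> acl S \<subseteq> acl T"
  unfolding acl_def by blast

lemma acl_polyfun:
  fixes f :: "('v::countable \<Rightarrow> 'a::alg_closed_field) \<Rightarrow> 'a"
  assumes "f \<in> polyfun" "\<And>j. j \<noteq> i \<Longrightarrow> e j \<in> insert 0 S"
    "f (e(i := x)) = 0" "\<not> (\<forall>z. f (e(i := z)) = 0)"
  shows "x \<in> acl S"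
proof -
  define e' where "e' n = (if \<exists>v. v \<noteq> i \<and> n = to_nat v then e (from_nat n) else 0)" for n :: nat
  have *: "(\<lambda>v. (e'(to_nat i := y)) (to_nat v)) = e(i := y)" for y
    by (auto simp: e'_def)
  have "(\<lambda>e. f (\<lambda>v. e (to_nat v))) \<in> polyfun" by (rule polyfun_rename) fact
  moreover have "e' j \<in> insert 0 S" for j
    unfolding e'_def using assms(2)[of "from_nat j"] by auto
  ultimately show ?thesis unfolding acl_def using assms(3,4) *
    by (intro CollectI bexI[of _ "\<lambda>e. f (\<lambda>v. e (to_nat v))"] exI[of _ e'] exI[of _ "to_nat i"]) auto
qed

lemma generic_iff_MOST:
  fixes P :: "('v::countable \<Rightarrow> 'a::alg_closed_field) \<Rightarrow> bool"
  assumes "P \<in> definable" "\<And>j. j \<noteq> i \<Longrightarrow> e j \<in> insert 0 S" "x \<notin> acl S"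
  shows "P (e(i := x)) \<longleftrightarrow> (MOST z. P (e(i := z)))"
  using assms(1)
proof induction
  case (zero f)
  then show ?case using acl_polyfun[OF zero, of i e S x] assms(2,3)
      MOST_polyfun_eq_0(1)[OF zero, of e i] by blast
next
  case (neg P)
  then show ?case by (simp add: MOST_definable_not del: fun_upd_apply)
next
  case (conj P Q)
  then show ?case by (simp add: eventually_conj_iff del: fun_upd_apply)
qed

lemma acl_definable:
  fixes P :: "('v::countable \<Rightarrow> 'a::alg_closed_field) \<Rightarrow> bool"
  assumes "P \<in> definable" "\<And>j. j \<noteq> i \<Longrightarrow> e j \<in> insert 0 S"
    "P (e(i := x))" "finite {z. P (e(i := z))}"
  shows "x \<in> acl S"
proof (rule ccontr)
  assume "x \<notin> acl S"
  then have "MOST z. P (e(i := z))" using generic_iff_MOST[OF assms(1), of i e S x] assms(2,3) by blast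
  then have "finite ({z. P (e(i := z))} \<union> {z. \<not> P (e(i := z))})"
    using assms(4) by (simp add: eventually_cofinite del: fun_upd_apply)
  moreover have "{z. P (e(i := z))} \<union> {z. \<not> P (e(i := z))} = UNIV" by auto
  ultimately have "finite (UNIV :: 'a set)" by simp
  then show False using infinite_UNIV_alg_closed by blast
qed

lemma acl_insertE:
  fixes x y :: "'a::alg_closed_field"
  assumes "x \<in> acl (insert y S)"
  obtains f :: "(nat \<Rightarrow> 'a) \<Rightarrow> 'a" and e :: "nat \<Rightarrow> 'a"
  where "f \<in> polyfun" "\<And>j. 2 \<le> j \<Longrightarrow> e j \<in> insert 0 S" "f (e(0 := x, 1 := y)) = 0"
    "\<not> (\<forall>z. f (e(0 := z, 1 := y)) = 0)"
proof -
  obtain f :: "(nat \<Rightarrow> 'a) \<Rightarrow> 'a" and e i where f: "f \<in> polyfun"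
    "\<forall>j. j \<noteq> i \<longrightarrow> e j \<in> insert 0 (insert y S)" "f (e(i := x)) = 0" "\<not> (\<forall>z. f (e(i := z)) = 0)"
    using assms unfolding acl_def by blast
  define r where "r j = (if j = i then 0 else if e j \<in> insert 0 S then j + 2 else 1)" for j
  define e' where "e' j = (if 2 \<le> j \<and> e (j - 2) \<in> insert 0 S then e (j - 2) else 0)" for j
  have *: "(\<lambda>v. (e'(0 := z, 1 := y)) (r v)) = e(i := z)" for z
  proof
    fix v
    show "(e'(0 := z, 1 := y)) (r v) = (e(i := z)) v"
      using f(2) by (cases "v = i"; cases "e v \<in> insert 0 S") (auto simp: r_def e'_def)
  qed
  show ?thesis
  proof (rule that)
    show "(\<lambda>e. f (\<lambda>v. e (r v))) \<in> polyfun" by (rule polyfun_rename) fact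
    show "\<And>j. 2 \<le> j \<Longrightarrow> e' j \<in> insert 0 S" by (auto simp: e'_def)
  qed (use f * in auto)
qed

lemma acl_trans:
  assumes "x \<in> acl (insert y S)" "y \<in> acl S"
  shows "x \<in> acl S"
proof -
  obtain f e where f: "f \<in> polyfun" "\<And>j. (2::nat) \<le> j \<Longrightarrow> e j \<in> insert 0 S"
    "f (e(0 := x, 1 := y)) = 0" "\<not> (\<forall>z. f (e(0 := z, 1 := y)) = 0)"
    using acl_insertE[OF assms(1)] by metis
  obtain h :: "(nat \<Rightarrow> 'a) \<Rightarrow> 'a" and e' i where h: "h \<in> polyfun"
    "\<forall>j. j \<noteq> i \<longrightarrow> e' j \<in> insert 0 S" "h (e'(i := y)) = 0" "\<not> (\<forall>z. h (e'(i := z)) = 0)"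
    using assms(2) unfolding acl_def by blast
  define E :: "nat + nat \<Rightarrow> 'a" where
    "E = case_sum (\<lambda>j. if j < 2 then 0 else e j) (\<lambda>j. if j = i then 0 else e' j)"
  define r :: "nat \<Rightarrow> nat + nat" where "r j = (if j = i then Inl 1 else Inr j)" for j
  let ?f = "\<lambda>E. f (\<lambda>v. E (Inl v)) :: 'a" and ?h = "\<lambda>E. h (\<lambda>v. E (r v)) :: 'a"
  have Ef: "(\<lambda>v. (E(Inl 0 := x, Inl 1 := y)) (Inl v)) = e(0 := x, 1 := y)" for x y
    by (auto simp: E_def)
  have Et: "E(Inl 0 := x, Inl 1 := y, Inl 0 := z) = E(Inl 0 := z, Inl 1 := y)" for x y z
    by auto
  have Eh: "(\<lambda>v. (E(Inl 0 := x, Inl 1 := y)) (r v)) = e'(i := y)" for x y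
    by (auto simp: E_def r_def)
  define P where "P E \<longleftrightarrow> ?h E = 0 \<and> ?f E = 0 \<and> \<not> (MOST z. ?f (E(Inl 0 := z)) = 0)" for E
  have F: "(\<lambda>E. ?f E = 0) \<in> definable" by (rule definable.zero[OF polyfun_rename[OF f(1)]])
  have H: "(\<lambda>E. ?h E = 0) \<in> definable" by (rule definable.zero[OF polyfun_rename[OF h(1)]])
  have "P \<in> definable"
    unfolding P_def[abs_def]
    by (rule definable.conj[OF H definable.conj[OF F definable.neg[OF definable_MOST[OF F]]]])
  then have "(\<lambda>E. \<exists>y. P (E(Inl 1 := y))) \<in> definable" by (rule definable_ex)
  moreover have PE: "P (E(Inl 0 := x, Inl 1 := y)) \<longleftrightarrow> h (e'(i := y)) = 0 \<and> f (e(0 := x, 1 := y)) = 0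
    \<and> \<not> (MOST z. f (e(0 := z, 1 := y)) = 0)" for x y
    by (simp only: P_def Eh Ef Et)
  have tw: "e(0 := z, 1 := y) = e(1 := y, 0 := z)" for z y by auto
  have M: "(MOST z. f (e(0 := z, 1 := y)) = 0) \<longleftrightarrow> (\<forall>z. f (e(0 := z, 1 := y)) = 0)" for y
    unfolding tw by (rule MOST_polyfun_eq_0(1)[OF f(1)])
  have "finite {z. \<exists>y. P (E(Inl 0 := z, Inl 1 := y))}"
  proof (rule finite_subset)
    show "{z. \<exists>y. P (E(Inl 0 := z, Inl 1 := y))} \<subseteq>
      (\<Union>y \<in> {y. h (e'(i := y)) = 0}. if \<forall>z. f (e(0 := z, 1 := y)) = 0 then {} else {z. f (e(0 := z, 1 := y)) = 0})"
      unfolding PE M by auto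
    show "finite \<dots>"
    proof (intro finite_UN_I)
      show "finite {y. h (e'(i := y)) = 0}"
        using MOST_polyfun_eq_0(2)[OF h(1)] h(4) by (simp add: eventually_cofinite del: fun_upd_apply)
      fix y
      show "finite (if \<forall>z. f (e(0 := z, 1 := y)) = 0 then {} else {z. f (e(0 := z, 1 := y)) = 0})"
        using MOST_polyfun_eq_0(2)[OF f(1), of "e(1 := y)" 0] unfolding tw
        by (simp add: eventually_cofinite del: fun_upd_apply)
    qed
  qed
  moreover have "\<exists>y. P (E(Inl 0 := x, Inl 1 := y))"
    unfolding PE M using f h by blast
  moreover have "E j \<in> insert 0 S" if "j \<noteq> Inl 0" for j
    using f(2) h(2) that by (cases j) (auto simp: E_def)
  ultimately show ?thesis
    by (intro acl_definable[where i = "Inl 0" and e = E and P = "\<lambda>E. \<exists>y. P (E(Inl 1 := y))"])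
qed

lemma acl_superset: "S \<subseteq> acl (S :: 'a::alg_closed_field set)"
proof
  fix x assume x: "x \<in> S"
  show "x \<in> acl S"
  proof (rule acl_polyfun[where f = "\<lambda>e :: nat \<Rightarrow> 'a. e 0 - e 1" and i = 0 and e = "\<lambda>_. x"])
    show "\<not> (\<forall>z. ((\<lambda>_::nat. x)(0 := z)) 0 - ((\<lambda>_::nat. x)(0 := z)) 1 = 0)"
      by (intro notI) (drule spec[of _ "x + 1"], simp)
  qed (use x in \<open>auto intro: polyfun.intros\<close>)
qed

lemma acl_exchange:
  fixes x y :: "'a::alg_closed_field"
  assumes "x \<in> acl (insert y S)" "x \<notin> acl S"
  shows "y \<in> acl (insert x S)"
proof (rule ccontr)
  assume y: "y \<notin> acl (insert x S)"
  obtain f e where f: "f \<in> polyfun" "\<And>j. (2::nat) \<le> j \<Longrightarrow> e j \<in> insert 0 S"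
    "f (e(0 := x, 1 := y)) = 0" "\<not> (\<forall>z. f (e(0 := z, 1 := y)) = 0)"
    using acl_insertE[OF assms(1)] by metis
  define P where "P e \<longleftrightarrow> f e = 0 \<and> \<not> (MOST z. f (e(0 := z)) = 0)" for e
  have P: "P \<in> definable"
    unfolding P_def[abs_def]
    by (rule definable.conj[OF definable.zero definable.neg[OF definable_MOST[OF definable.zero]]])
      (rule f(1))+
  define e' where "e' j = (if 2 \<le> j then e j else 0)" for j
  have e': "e'(0 := x, 1 := y) = e(0 := x, 1 := y)" for x y by (auto simp: e'_def)
  have e'': "e(0 := x, 1 := y, 0 := z) = e(0 := z, 1 := y)" for x y z by auto
  have tw: "e(0 := z, 1 := y) = e(1 := y, 0 := z)" for z y by auto
  have M: "(MOST z. f (e(0 := z, 1 := y)) = 0) \<longleftrightarrow> (\<forall>z. f (e(0 := z, 1 := y)) = 0)"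
    "(MOST z. f (e(0 := z, 1 := y)) \<noteq> 0) \<longleftrightarrow> \<not> (\<forall>z. f (e(0 := z, 1 := y)) = 0)" for y
    unfolding tw by (rule MOST_polyfun_eq_0[OF f(1)])+
  have PE: "P (e'(0 := x, 1 := y)) \<longleftrightarrow> f (e(0 := x, 1 := y)) = 0 \<and> \<not> (\<forall>z. f (e(0 := z, 1 := y)) = 0)" for x y
    by (simp only: P_def e' e'' M)
  have "P (e'(0 := x, 1 := y))" unfolding PE using f by blast
  moreover have S: "e' j \<in> insert 0 S" for j using f(2)[of j] by (simp add: e'_def)
  then have "(e'(0 := x)) j \<in> insert 0 (insert x S)" for j by auto
  ultimately have "MOST y. P (e'(0 := x, 1 := y))"
    using generic_iff_MOST[OF P _ y, of 1 "e'(0 := x)"] by blast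
  then have "MOST x. MOST y. P (e'(0 := x, 1 := y))"
    using generic_iff_MOST[OF definable_MOST[OF P], of 0 e' S x 1] S assms(2) by blast
  then have "MOST y. MOST x. P (e'(0 := x, 1 := y))" by (simp add: MOST_commute[OF P])
  moreover have "\<not> (MOST x. P (e'(0 := x, 1 := y)))" for y
  proof
    assume A: "MOST x. P (e'(0 := x, 1 := y))"
    then obtain x where "P (e'(0 := x, 1 := y))"
      using infinite_UNIV_alg_closed[where 'a = 'a] eventually_happens[OF A] by auto
    then have "MOST x. f (e(0 := x, 1 := y)) \<noteq> 0" unfolding M PE by blast
    with A have "MOST x :: 'a. False" unfolding PE by eventually_elim blast
    then show False using infinite_UNIV_alg_closed[where 'a = 'a] by simp
  qed
  ultimately have "MOST y :: 'a. False" by (simp only:)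
  then show False using infinite_UNIV_alg_closed[where 'a = 'a] by simp
qed

lemma acl_trans_finite:
  assumes "finite T" "T \<subseteq> acl S" "x \<in> acl (T \<union> S)"
  shows "x \<in> acl S"
  using assms
proof (induction T arbitrary: x)
  case (insert y T)
  have "y \<in> acl (T \<union> S)" using insert.prems acl_mono[of S "T \<union> S"] by auto
  then have "x \<in> acl (T \<union> S)" using acl_trans[of x y "T \<union> S"] insert.prems(2) by simp
  then show ?case using insert.IH insert.prems(1) by simp
qed simp

lemma acl_add: "x \<in> acl S \<Longrightarrow> y \<in> acl S \<Longrightarrow> x + y \<in> acl S"
  and acl_diff: "x \<in> acl S \<Longrightarrow> y \<in> acl S \<Longrightarrow> x - y \<in> acl S"
  and acl_mult: "x \<in> acl S \<Longrightarrow> y \<in> acl S \<Longrightarrow> x * y \<in> acl S"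
  and acl_divide: "x \<in> acl S \<Longrightarrow> y \<in> acl S \<Longrightarrow> x / y \<in> acl S"
  for x y :: "'a::alg_closed_field"
proof -
  assume xy: "x \<in> acl S" "y \<in> acl S"
  define e :: "nat \<Rightarrow> 'a" where "e j = (if j = 1 then x else y)" for j
  have *: "g (e(0 := x)) \<in> acl S" if "g \<in> polyfun" "\<And>z z'. g (e(0 := z)) = g (e(0 := z'))" for g
  proof -
    define c where "c = g (e(0 := x))"
    have c: "g (e(0 := z)) = c" for z unfolding c_def by (rule that(2))
    have "c \<in> acl ({x, y} \<union> S)"
    proof (rule acl_polyfun[where f = "\<lambda>e. e 0 - g e" and i = 0 and e = e])
      show "(\<lambda>e. e 0 - g e) \<in> polyfun" by (intro polyfun.intros that)
      show "(e(0 := c)) 0 - g (e(0 := c)) = 0" by (simp add: c fun_upd_same del: fun_upd_apply)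
      show "\<not> (\<forall>z. (e(0 := z)) 0 - g (e(0 := z)) = 0)"
        by (intro notI) (drule spec[of _ "c + 1"], simp add: c fun_upd_same del: fun_upd_apply)
    qed (auto simp: e_def)
    then have "c \<in> acl S" using xy by (intro acl_trans_finite[of "{x, y}" S]) auto
    then show ?thesis by (simp add: c_def)
  qed
  show "x + y \<in> acl S" "x - y \<in> acl S" "x * y \<in> acl S"
    using *[of "\<lambda>e. e 1 + e 2"] *[of "\<lambda>e. e 1 - e 2"] *[of "\<lambda>e. e 1 * e 2"]
    by (simp_all add: e_def polyfun.intros)
  show "x / y \<in> acl S"
  proof (cases "y = 0")
    case True
    then show ?thesis using xy by simp
  next
    case False
    have "x / y \<in> acl ({x, y} \<union> S)"
    proof (rule acl_polyfun[where f = "\<lambda>e. e 0 * e 2 - e 1" and i = 0 and e = e])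
      show "\<not> (\<forall>z. (e(0 := z)) 0 * (e(0 := z)) 2 - (e(0 := z)) 1 = 0)"
        by (intro notI) (drule spec[of _ "(x + 1) / y"], use False in \<open>simp add: e_def\<close>)
    qed (use False in \<open>auto simp: e_def intro!: polyfun.intros\<close>)
    then show ?thesis using xy by (intro acl_trans_finite[of "{x, y}" S]) auto
  qed
qed

lemma acl_0: "0 \<in> acl S" and acl_1: "1 \<in> acl S"
  for S :: "'a::alg_closed_field set"
proof -
  have "1 \<in> acl S"
    by (rule acl_polyfun[where f = "\<lambda>e :: nat \<Rightarrow> 'a. e 0 - 1" and i = 0 and e = "\<lambda>_. 0"])
      (auto intro!: polyfun.intros exI[of _ 0])
  then show "1 \<in> acl S" "0 \<in> acl S" using acl_diff[of 1 S 1] by auto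
qed

lemma acl_sum: "(\<And>i. i \<in> A \<Longrightarrow> f i \<in> acl S) \<Longrightarrow> sum f A \<in> acl S"
  by (induction A rule: infinite_finite_induct) (auto intro: acl_0 acl_add)

lemma acl_power: "x \<in> acl S \<Longrightarrow> x ^ n \<in> acl S"
  by (induction n) (auto intro: acl_1 acl_mult)

datatype 'v polyterm = One | Var 'v | Add "'v polyterm" "'v polyterm"
  | Diff "'v polyterm" "'v polyterm" | Mult "'v polyterm" "'v polyterm"

instance polyterm :: (countable) countable
  by countable_datatype

primrec polyterm_eval :: "'v polyterm \<Rightarrow> ('v \<Rightarrow> 'a::comm_ring_1) \<Rightarrow> 'a" where
  "polyterm_eval One e = 1"
| "polyterm_eval (Var v) e = e v"
| "polyterm_eval (Add s t) e = polyterm_eval s e + polyterm_eval t e"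
| "polyterm_eval (Diff s t) e = polyterm_eval s e - polyterm_eval t e"
| "polyterm_eval (Mult s t) e = polyterm_eval s e * polyterm_eval t e"

lemma countable_polyfun: "countable (polyfun :: (('v::countable \<Rightarrow> 'a::comm_ring_1) \<Rightarrow> 'a) set)"
proof -
  have "\<exists>t. f = polyterm_eval t" if "f \<in> polyfun" for f :: "('v \<Rightarrow> 'a) \<Rightarrow> 'a"
    using that
  proof induction
    case one
    show ?case by (intro exI[of _ One]) auto
  next
    case (var v)
    show ?case by (intro exI[of _ "Var v"]) auto
  next
    case (add f g)
    then obtain s t where "f = polyterm_eval s" "g = polyterm_eval t" by blast
    then show ?case by (intro exI[of _ "Add s t"]) auto
  next
    case (diff f g)
    then obtain s t where "f = polyterm_eval s" "g = polyterm_eval t" by blast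
    then show ?case by (intro exI[of _ "Diff s t"]) auto
  next
    case (mult f g)
    then obtain s t where "f = polyterm_eval s" "g = polyterm_eval t" by blast
    then show ?case by (intro exI[of _ "Mult s t"]) auto
  qed
  then have "(polyfun :: (('v \<Rightarrow> 'a) \<Rightarrow> 'a) set) \<subseteq> range polyterm_eval" by blast
  then show ?thesis by (rule countable_subset) simp
qed

lemma polyfun_finite_support:
  fixes f :: "(nat \<Rightarrow> 'a::comm_ring_1) \<Rightarrow> 'a"
  assumes "f \<in> polyfun"
  shows "\<exists>n. \<forall>e e'. (\<forall>j<n. e j = e' j) \<longrightarrow> f e = f e'"
  using assms
proof induction
  case (var v)
  show ?case by (intro exI[of _ "Suc v"]) auto
next
  case (add f g)
  then obtain n m where "\<forall>e e'. (\<forall>j<n. e j = e' j) \<longrightarrow> f e = f e'"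
    "\<forall>e e'. (\<forall>j<m. e j = e' j) \<longrightarrow> g e = g e'" by blast
  then show ?case by (intro exI[of _ "max n m"]) (metis less_max_iff_disj)
next
  case (diff f g)
  then obtain n m where "\<forall>e e'. (\<forall>j<n. e j = e' j) \<longrightarrow> f e = f e'"
    "\<forall>e e'. (\<forall>j<m. e j = e' j) \<longrightarrow> g e = g e'" by blast
  then show ?case by (intro exI[of _ "max n m"]) (metis less_max_iff_disj)
next
  case (mult f g)
  then obtain n m where "\<forall>e e'. (\<forall>j<n. e j = e' j) \<longrightarrow> f e = f e'"
    "\<forall>e e'. (\<forall>j<m. e j = e' j) \<longrightarrow> g e = g e'" by blast
  then show ?case by (intro exI[of _ "max n m"]) (metis less_max_iff_disj)
qed auto

lemma countable_acl:
  fixes S :: "'a::alg_closed_field set"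
  assumes "countable S"
  shows "countable (acl S)"
proof (rule countable_subset)
  define ext where "ext l j = (if j < length l then l ! j else 0)" for l :: "'a list" and j
  define R where "R f l i = (if \<forall>z. f ((ext l)(i := z)) = 0 then {} else {z. f ((ext l)(i := z)) = 0})"
    for f :: "(nat \<Rightarrow> 'a) \<Rightarrow> 'a" and l i
  show "acl S \<subseteq> (\<Union>f\<in>polyfun. \<Union>l\<in>lists (insert 0 S). \<Union>i. R f l i)"
  proof
    fix x assume "x \<in> acl S"
    then obtain f :: "(nat \<Rightarrow> 'a) \<Rightarrow> 'a" and e i where f: "f \<in> polyfun"
      "\<forall>j. j \<noteq> i \<longrightarrow> e j \<in> insert 0 S" "f (e(i := x)) = 0" "\<not> (\<forall>z. f (e(i := z)) = 0)"
      unfolding acl_def by blast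
    obtain n where n: "\<forall>e e'. (\<forall>j<n. e j = e' j) \<longrightarrow> f e = f e'"
      using polyfun_finite_support[OF f(1)] by blast
    define l where "l = map (\<lambda>j. if j = i then 0 else e j) [0..<n]"
    have "f ((ext l)(i := z)) = f (e(i := z))" for z
      by (rule n[rule_format]) (auto simp: ext_def l_def)
    then have "x \<in> R f l i" using f(3,4) by (auto simp: R_def simp del: fun_upd_apply)
    moreover have "l \<in> lists (insert 0 S)" using f(2) by (auto simp: l_def)
    ultimately show "x \<in> (\<Union>f\<in>polyfun. \<Union>l\<in>lists (insert 0 S). \<Union>i. R f l i)" using f(1) by blast
  qed
  show "countable (\<Union>f\<in>polyfun. \<Union>l\<in>lists (insert 0 S). \<Union>i. R f l i)"
  proof (intro countable_UN countable_polyfun countable_lists)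
    show "countable (insert 0 S)" using assms by simp
    fix f l i assume "f \<in> (polyfun :: ((nat \<Rightarrow> 'a) \<Rightarrow> 'a) set)"
    then have "finite (R f l i)" using MOST_polyfun_eq_0(2)[of f "ext l" i]
      by (auto simp: R_def eventually_cofinite simp del: fun_upd_apply)
    then show "countable (R f l i)" by (rule countable_finite)
  qed simp
qed

primrec acl_indep :: "'a::alg_closed_field set \<Rightarrow> 'a list \<Rightarrow> bool" where
  "acl_indep S [] \<longleftrightarrow> True"
| "acl_indep S (x # xs) \<longleftrightarrow> x \<notin> acl S \<and> acl_indep (insert x S) xs"

lemma acl_indep_append: "acl_indep S (xs @ ys) \<longleftrightarrow> acl_indep S xs \<and> acl_indep (set xs \<union> S) ys"
  by (induction xs arbitrary: S) simp_all

lemma acl_indep_length_le: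
  assumes "finite T" "set xs \<subseteq> acl (T \<union> S)" "acl_indep S xs"
  shows "length xs \<le> card T"
  using assms
proof (induction xs arbitrary: S T)
  case (Cons x xs)
  have "\<exists>T1 y. T1 \<subseteq> T \<and> y \<in> T - T1 \<and> x \<notin> acl (T1 \<union> S) \<and> x \<in> acl (insert y (T1 \<union> S))"
  proof -
    have "x \<notin> acl S" "x \<in> acl (T \<union> S)" using Cons.prems by auto
    with \<open>finite T\<close> show ?thesis
    proof (induction T)
      case (insert y T)
      show ?case
      proof (cases "x \<in> acl (T \<union> S)")
        case True
        then show ?thesis using insert.IH[OF insert.prems(1) True] by blast
      next
        case False
        then show ?thesis using insert by (intro exI[of _ T] exI[of _ y]) auto
      qed
    qed simp
  qed
  then obtain T1 y where T1: "T1 \<subseteq> T" "y \<in> T" "y \<notin> T1" "x \<notin> acl (T1 \<union> S)"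
    "x \<in> acl (insert y (T1 \<union> S))" by blast
  let ?T = "T - {y}"
  have "y \<in> acl (insert x (T1 \<union> S))" using acl_exchange T1 by blast
  then have y: "y \<in> acl (?T \<union> insert x S)"
    using acl_mono[of "insert x (T1 \<union> S)" "?T \<union> insert x S"] T1 by auto
  have "set xs \<subseteq> acl (?T \<union> insert x S)"
  proof
    fix z assume "z \<in> set xs"
    then have "z \<in> acl (T \<union> S)" using Cons.prems by auto
    moreover have "acl (T \<union> S) \<subseteq> acl (insert y (?T \<union> insert x S))" by (rule acl_mono) auto
    ultimately show "z \<in> acl (?T \<union> insert x S)" using acl_trans[OF _ y] by blast
  qed
  then have "length xs \<le> card ?T" using Cons by (intro Cons.IH[of ?T "insert x S"]) auto
  moreover have "card T > 0" using T1(2) Cons.prems(1) card_gt_0_iff by blast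
  ultimately show ?case using Cons.prems(1) T1(2) by simp
qed simp

text \<open>The fibre over \<open>e\<close> has dimension at least \<open>b\<close> in the coordinates \<open>vs\<close>.\<close>

primrec dim_ge :: "'v list \<Rightarrow> nat \<Rightarrow> (('v \<Rightarrow> 'a) \<Rightarrow> bool) \<Rightarrow> ('v \<Rightarrow> 'a) \<Rightarrow> bool" where
  "dim_ge [] b P e \<longleftrightarrow> b = 0 \<and> P e"
| "dim_ge (v # vs) b P e \<longleftrightarrow> (\<exists>x. dim_ge vs b P (e(v := x)))
     \<or> 0 < b \<and> (MOST x. dim_ge vs (b - 1) P (e(v := x)))"

lemma definable_dim_ge:
  fixes P :: "('v \<Rightarrow> 'a::alg_closed_field) \<Rightarrow> bool"
  assumes "P \<in> definable"
  shows "dim_ge vs b P \<in> definable"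
proof (induction vs arbitrary: b)
  case Nil
  have "(\<lambda>e. b = 0 \<and> P e) \<in> definable"
    using assms by (cases "b = 0") (simp_all add: definable_False)
  then show ?case by (simp add: ext[of "dim_ge [] b P" "\<lambda>e. b = 0 \<and> P e"])
next
  case (Cons v vs)
  have "(\<lambda>e. 0 < b \<and> (MOST x. dim_ge vs (b - 1) P (e(v := x)))) \<in> definable"
    by (cases "b = 0") (simp_all add: definable_False definable_MOST[OF Cons.IH] del: fun_upd_apply)
  then have "(\<lambda>e. (\<exists>x. dim_ge vs b P (e(v := x)))
     \<or> 0 < b \<and> (MOST x. dim_ge vs (b - 1) P (e(v := x)))) \<in> definable"
    by (intro definable_disj definable_ex Cons.IH)
  also have "(\<lambda>e. (\<exists>x. dim_ge vs b P (e(v := x)))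
     \<or> 0 < b \<and> (MOST x. dim_ge vs (b - 1) P (e(v := x)))) = dim_ge (v # vs) b P"
    by (intro ext) simp
  finally show ?case .
qed

definition points :: "'v set \<Rightarrow> 'a set \<Rightarrow> (('v \<Rightarrow> 'a) \<Rightarrow> bool) \<Rightarrow> ('v \<Rightarrow> 'a) \<Rightarrow> ('v \<Rightarrow> 'a) set" where
  "points V F P e = {z. (\<forall>v. v \<notin> V \<longrightarrow> z v = e v) \<and> (\<forall>v\<in>V. z v \<in> F) \<and> P z}"

lemma points_empty: "points {} F P e = (if P e then {e} else {})"
proof -
  have "(\<forall>v. z v = e v) \<longleftrightarrow> z = e" for z by auto
  then show ?thesis by (auto simp: points_def)
qed

lemma points_insert:
  assumes "v \<notin> V"
  shows "points (insert v V) F P e = (\<Union>x\<in>F. points V F P (e(v := x)))"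
proof (intro equalityI subsetI)
  fix z assume "z \<in> points (insert v V) F P e"
  then have "z v \<in> F" "z \<in> points V F P (e(v := z v))" by (auto simp: points_def)
  then show "z \<in> (\<Union>x\<in>F. points V F P (e(v := x)))" by blast
next
  fix z assume "z \<in> (\<Union>x\<in>F. points V F P (e(v := x)))"
  then show "z \<in> points (insert v V) F P e"
    using assms by (auto simp: points_def split: if_splits)
qed

lemma finite_points:
  assumes "finite V" "finite F"
  shows "finite (points V F P e)"
  using assms(1)
  by (induction V arbitrary: e) (auto simp: points_empty points_insert assms(2))

lemma dim_ge_0: "z \<in> points (set vs) F P e \<Longrightarrow> distinct vs \<Longrightarrow> dim_ge vs 0 P e"
  by (induction vs arbitrary: e) (auto simp: points_empty points_insert split: if_splits)

text \<open>The extra factor \<open>card F\<close> on the left avoids the exponent \<open>b - 1\<close>.\<close>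

theorem card_points_le:
  fixes P :: "('v \<Rightarrow> 'a::alg_closed_field) \<Rightarrow> bool"
  assumes "P \<in> definable" "distinct vs"
  shows "\<exists>D. \<forall>F e. finite F \<longrightarrow> \<not> dim_ge vs b P e
    \<longrightarrow> card (points (set vs) F P e) * card F \<le> D * card F ^ b"
  using assms(2)
proof (induction vs arbitrary: b)
  case Nil
  have "card F \<le> card F ^ b" if "b \<noteq> 0" for F :: "'a set"
    using that by (cases "card F = 0") (auto intro: self_le_power)
  then show ?case by (intro exI[of _ 1]) (auto simp: points_empty)
next
  case (Cons v vs)
  show ?case
  proof (cases b)
    case 0
    have "points (set (v # vs)) F P e = {}" if "\<not> dim_ge (v # vs) b P e" for F e
      using dim_ge_0[OF _ Cons.prems, of _ F P e] that unfolding 0 by blast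
    then show ?thesis by (intro exI[of _ 0]) simp
  next
    case (Suc b')
    obtain D where D: "\<And>F e. finite F \<Longrightarrow> \<not> dim_ge vs b P e
        \<Longrightarrow> card (points (set vs) F P e) * card F \<le> D * card F ^ b"
      using Cons by (metis distinct.simps(2))
    obtain D' where D': "\<And>F e. finite F \<Longrightarrow> \<not> dim_ge vs b' P e
        \<Longrightarrow> card (points (set vs) F P e) * card F \<le> D' * card F ^ b'"
      using Cons by (metis distinct.simps(2))
    obtain N where N: "\<And>e. \<not> (MOST x. dim_ge vs b' P (e(v := x))) \<Longrightarrow>
        finite {x. dim_ge vs b' P (e(v := x))} \<and> card {x. dim_ge vs b' P (e(v := x))} \<le> N"
      using definable_fibre_bound[OF definable_dim_ge[OF assms(1)]] by metis
    show ?thesis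
    proof (intro exI[of _ "N * D + D'"] allI impI)
      fix F :: "'a set" and e
      assume F: "finite F" and e: "\<not> dim_ge (v # vs) b P e"
      let ?c = "\<lambda>x. card (points (set vs) F P (e(v := x))) * card F"
      define A where "A = {x \<in> F. dim_ge vs b' P (e(v := x))}"
      have A: "A \<subseteq> F" "card A \<le> N"
      proof -
        have "\<not> (MOST x. dim_ge vs b' P (e(v := x)))" using e Suc by simp
        with N have "finite {x. dim_ge vs b' P (e(v := x))}" "card {x. dim_ge vs b' P (e(v := x))} \<le> N"
          by blast+
        moreover have "A \<subseteq> {x. dim_ge vs b' P (e(v := x))}" by (auto simp: A_def)
        ultimately show "card A \<le> N" using card_mono order_trans by blast
      qed (auto simp: A_def)
      have "card (points (set (v # vs)) F P e) \<le> (\<Sum>x\<in>F. card (points (set vs) F P (e(v := x))))"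
        using Cons.prems F by (simp add: points_insert card_UN_le del: fun_upd_apply)
      then have "card (points (set (v # vs)) F P e) * card F \<le> (\<Sum>x\<in>F. ?c x)"
        unfolding sum_distrib_right[symmetric] by (rule mult_le_mono1)
      also have "\<dots> = (\<Sum>x\<in>A. ?c x) + (\<Sum>x\<in>F - A. ?c x)"
        using sum.subset_diff[OF A(1) F, of ?c] by simp
      also have "(\<Sum>x\<in>A. ?c x) \<le> (\<Sum>x\<in>A. D * card F ^ b)"
        using e by (intro sum_mono D F) auto
      also have "\<dots> \<le> N * (D * card F ^ b)" using A(2) by (simp del: mult_le_cancel2 add: mult_le_mono1)
      also have "(\<Sum>x\<in>F - A. ?c x) \<le> (\<Sum>x\<in>F - A. D' * card F ^ b')"
        by (intro sum_mono D' F) (auto simp: A_def)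
      also have "\<dots> \<le> card F * (D' * card F ^ b')"
        using card_mono[OF F, of "F - A"] by (simp del: mult_le_cancel2 add: mult_le_mono1)
      also have "N * (D * card F ^ b) + card F * (D' * card F ^ b') = (N * D + D') * card F ^ b"
        using Suc by (simp add: algebra_simps)
      finally show "card (points (set (v # vs)) F P e) * card F \<le> (N * D + D') * card F ^ b"
        by simp
    qed
  qed
qed

lemma MOST_imp_ex_not_acl:
  fixes S :: "'a::alg_closed_field set"
  assumes "uncountable (UNIV :: 'a set)" "countable S" "MOST x. P x"
  shows "\<exists>x. x \<notin> acl S \<and> P x"
proof (rule ccontr)
  assume "\<not> ?thesis"
  then have "UNIV \<subseteq> acl S \<union> {x. \<not> P x}" by blast
  moreover have "countable (acl S \<union> {x. \<not> P x})"
    using assms countable_acl by (auto simp: eventually_cofinite intro: countable_finite)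
  ultimately show False using assms(1) countable_subset by blast
qed

lemma dim_ge_generic:
  fixes P :: "('v \<Rightarrow> 'a::alg_closed_field) \<Rightarrow> bool"
  assumes "uncountable (UNIV :: 'a set)" "countable S" "distinct vs" "dim_ge vs b P e"
  shows "\<exists>z ws. (\<forall>v. v \<notin> set vs \<longrightarrow> z v = e v) \<and> P z \<and> set ws \<subseteq> set vs \<and> length ws = b
    \<and> acl_indep S (map z ws)"
  using assms(2-4)
proof (induction vs arbitrary: S b e)
  case Nil
  then show ?case by auto
next
  case (Cons v vs)
  from Cons.prems(3) consider x where "dim_ge vs b P (e(v := x))"
    | "0 < b" "MOST x. dim_ge vs (b - 1) P (e(v := x))" by auto
  then show ?case
  proof cases
    case 1
    then obtain z ws where "\<forall>u. u \<notin> set vs \<longrightarrow> z u = (e(v := x)) u" "P z" "set ws \<subseteq> set vs" "length ws = b"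
      "acl_indep S (map z ws)" using Cons.IH[OF Cons.prems(1) _ 1] Cons.prems(2) by auto
    then show ?thesis by (intro exI[of _ z] exI[of _ ws]) auto
  next
    case 2
    obtain x where x: "x \<notin> acl S" "dim_ge vs (b - 1) P (e(v := x))"
      using MOST_imp_ex_not_acl[OF assms(1) Cons.prems(1) 2(2)] by blast
    then obtain z ws where z: "\<forall>u. u \<notin> set vs \<longrightarrow> z u = (e(v := x)) u" "P z" "set ws \<subseteq> set vs"
      "length ws = b - 1" "acl_indep (insert x S) (map z ws)"
      using Cons.IH[OF _ _ x(2), of "insert x S"] Cons.prems by auto
    moreover have "z v = x" using z(1) Cons.prems(2) by auto
    ultimately show ?thesis using 2 x(1) by (intro exI[of _ z] exI[of _ "v # ws"]) auto
  qed
qed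

section \<open>Unions of paths, separation and interpolation\<close>

definition inner_verts :: "nat \<Rightarrow> (nat \<Rightarrow> 'b) set \<Rightarrow> 'b set" where
  "inner_verts k T = (\<Union>p\<in>T. p ` {1..<k})"

definition path_edges :: "nat \<Rightarrow> (nat \<Rightarrow> 'b) set \<Rightarrow> 'b set set" where
  "path_edges k T = (\<Union>p\<in>T. (\<lambda>i. {p i, p (Suc i)}) ` {..<k})"

lemma card_pred_image_Un:
  fixes J :: "nat set"
  assumes "finite J" "J \<noteq> {}" "0 \<notin> J"
  shows "Suc (card J) \<le> card (J \<union> (\<lambda>i. i - 1) ` J)"
proof -
  have "Min J \<in> J" using assms by simp
  then have "Min J > 0" using assms(3) by (metis gr0I)
  then have "Min J - 1 \<notin> J" using Min_le[OF assms(1), of "Min J - 1"] by auto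
  then have "card (insert (Min J - 1) J) = Suc (card J)" using assms(1) by simp
  moreover have "insert (Min J - 1) J \<subseteq> J \<union> (\<lambda>i. i - 1) ` J" using \<open>Min J \<in> J\<close> by blast
  ultimately show ?thesis using card_mono[of "J \<union> (\<lambda>i. i - 1) ` J" "insert (Min J - 1) J"] assms(1) by simp
qed

lemma path_edge_inj:
  assumes "inj_on p {..k}"
  shows "inj_on (\<lambda>i. {p i, p (Suc i)}) {..<k}"
proof (rule inj_onI)
  fix i j assume ij: "i \<in> {..<k}" "j \<in> {..<k}" "{p i, p (Suc i)} = {p j, p (Suc j)}"
  then consider "p i = p j" | "p i = p (Suc j)" "p (Suc i) = p j" by (auto simp: doubleton_eq_iff)
  then show "i = j"
  proof cases
    case 1
    then show ?thesis using inj_onD[OF assms 1] ij by auto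
  next
    case 2
    then show ?thesis using inj_onD[OF assms 2(1)] inj_onD[OF assms 2(2)] ij by auto
  qed
qed

text \<open>Add the paths one at a time: a path contributing \<open>j > 0\<close> new inner vertices contributes
  at least \<open>j + 1\<close> new edges, and \<open>k j \<le> (k - 1) (j + 1)\<close> because \<open>j \<le> k - 1\<close>.\<close>

lemma inner_verts_le_path_edges:
  assumes "finite T" "k \<ge> 1"
    "\<And>p. p \<in> T \<Longrightarrow> inj_on p {..k} \<and> p 0 = x \<and> p k = y"
  shows "k * card (inner_verts k T) \<le> (k - 1) * card (path_edges k T)"
  using assms(1,3)
proof (induction T)
  case empty
  then show ?case by (simp add: inner_verts_def)
next
  case (insert p T)
  let ?U = "inner_verts k T" and ?E = "path_edges k T" and ?e = "\<lambda>i. {p i, p (Suc i)}"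
  define J where "J = {i \<in> {1..<k}. p i \<notin> ?U}"
  define M where "M = J \<union> (\<lambda>i. i - 1) ` J"
  have inj: "inj_on p {..k}" "p 0 = x" "p k = y" using insert.prems by auto
  have fin: "finite ?U" "finite ?E" "finite J" "finite M"
    using insert.hyps by (auto simp: inner_verts_def path_edges_def J_def M_def)
  have U: "inner_verts k (insert p T) = ?U \<union> p ` J"
  proof -
    have "inner_verts k (insert p T) = ?U \<union> p ` {1..<k}" by (auto simp: inner_verts_def)
    also have "\<dots> = ?U \<union> p ` J" unfolding J_def by blast
    finally show ?thesis .
  qed
  have "card (p ` J) = card J"
    by (rule card_image) (rule inj_on_subset[OF inj(1)], auto simp: J_def)
  then have cU: "card (inner_verts k (insert p T)) = card ?U + card J"
    unfolding U using fin by (subst card_Un_disjoint) (auto simp: J_def)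
  have M: "M \<subseteq> {..<k}" by (auto simp: M_def J_def)
  have new: "p i \<notin> ?U \<union> {x, y}" if "i \<in> J" for i
  proof -
    have i: "1 \<le> i" "i < k" "p i \<notin> ?U" using that by (auto simp: J_def)
    then have "p i \<noteq> p 0" "p i \<noteq> p k" using inj_onD[OF inj(1), of i] by auto
    then show ?thesis using i inj by auto
  qed
  have old: "e \<subseteq> ?U \<union> {x, y}" if e: "e \<in> ?E" for e
  proof -
    obtain q i where q: "q \<in> T" "i < k" "e = {q i, q (Suc i)}"
      using e by (auto simp: path_edges_def)
    have "q j \<in> ?U \<union> {x, y}" if j: "j \<le> k" for j
    proof -
      consider "j = 0" | "j = k" | "j \<in> {1..<k}" using j by fastforce
      then show ?thesis
      proof cases
        case 3
        then show ?thesis using q(1) unfolding inner_verts_def by blast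
      qed (use q(1) insert.prems[of q] in auto)
    qed
    then show ?thesis using q by auto
  qed
  have "?e i \<notin> ?E" if "i \<in> M" for i
  proof -
    have "i \<in> J \<or> Suc i \<in> J" using that by (auto simp: M_def J_def)
    then show ?thesis using old[of "?e i"] new by auto
  qed
  then have "card (?E \<union> ?e ` M) = card ?E + card (?e ` M)"
    using fin by (intro card_Un_disjoint) auto
  also have "card (?e ` M) = card M"
    by (rule card_image[OF inj_on_subset[OF path_edge_inj[OF inj(1)] M]])
  finally have "card ?E + card M \<le> card (path_edges k (insert p T))"
    using card_mono[of "path_edges k (insert p T)" "?E \<union> ?e ` M"] M insert.hyps
    by (auto simp: path_edges_def)
  moreover have "k * card J \<le> (k - 1) * card M"
  proof (cases "J = {}")
    case False
    have "Suc (card J) \<le> card M" unfolding M_def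
      by (rule card_pred_image_Un) (use fin False in \<open>auto simp: J_def\<close>)
    moreover have "card J \<le> card {1..<k}" by (rule card_mono) (auto simp: J_def)
    then have "k * card J \<le> (k - 1) * Suc (card J)"
      using assms(2) by (cases k) auto
    ultimately show ?thesis by (meson le_trans mult_le_mono2)
  qed simp
  ultimately have "k * card ?U + k * card J \<le> (k - 1) * card (path_edges k (insert p T))"
    using insert.IH insert.prems
    by (smt (verit, best) add_mono distrib_left insertCI le_trans mult_le_mono2)
  then show ?case by (simp add: cU distrib_left)
qed

lemma card_inner_verts_le: "finite T \<Longrightarrow> card (inner_verts k T) \<le> card T * (k - 1)"
proof -
  assume "finite T"
  then have "card (inner_verts k T) \<le> (\<Sum>p\<in>T. card (p ` {1..<k}))"
    unfolding inner_verts_def by (rule card_UN_le)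
  also have "\<dots> \<le> (\<Sum>p\<in>T. k - 1)"
    by (intro sum_mono) (use card_image_le[of "{1..<k}"] in auto)
  finally show ?thesis by simp
qed

lemma card_path_edges_le: "finite T \<Longrightarrow> card (path_edges k T) \<le> card T * k"
proof -
  assume "finite T"
  then have "card (path_edges k T) \<le> (\<Sum>p\<in>T. card ((\<lambda>i. {p i, p (Suc i)}) ` {..<k}))"
    unfolding path_edges_def by (rule card_UN_le)
  also have "\<dots> \<le> (\<Sum>p\<in>T. k)"
    by (intro sum_mono) (use card_image_le[of "{..<k}"] in auto)
  finally show ?thesis by simp
qed

lemma finite_inner_verts: "finite T \<Longrightarrow> finite (inner_verts k T)"
  and finite_path_edges: "finite T \<Longrightarrow> finite (path_edges k T)"
  by (auto simp: inner_verts_def path_edges_def)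

lemma ex_separating_value:
  fixes lam :: "nat \<Rightarrow> 'a::idom" and q :: "'w \<Rightarrow> 'a poly"
  assumes "finite W" "inj_on q W" "\<And>w. w \<in> W \<Longrightarrow> degree (q w) \<le> m"
    "inj_on lam {..<L}" "card W * card W * m < L"
  shows "\<exists>b<L. inj_on (\<lambda>w. poly (q w) (lam b)) W"
proof (rule ccontr)
  assume no: "\<not> ?thesis"
  define B where "B = (\<lambda>(v, w). if v = w then {} else {b \<in> {..<L}. poly (q v - q w) (lam b) = 0})"
  have small: "card (B vw) \<le> m" if vw: "vw \<in> W \<times> W" for vw
  proof -
    obtain v w where [simp]: "vw = (v, w)" by fastforce
    have W: "v \<in> W" "w \<in> W" using vw by auto
    show ?thesis
    proof (cases "v = w")
      case False
      then have nz: "q v - q w \<noteq> 0" using assms(2) W by (auto dest: inj_onD)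
      have "card (B vw) = card (lam ` B vw)"
        by (rule card_image[symmetric]) (rule inj_on_subset[OF assms(4)], use False in \<open>auto simp: B_def\<close>)
      also have "\<dots> \<le> card {x. poly (q v - q w) x = 0}"
        by (rule card_mono[OF poly_roots_finite[OF nz]]) (use False in \<open>auto simp: B_def\<close>)
      also have "\<dots> \<le> degree (q v - q w)" by (rule card_poly_roots_bound[OF nz])
      also have "\<dots> \<le> m" by (rule degree_diff_le) (use assms(3) W in auto)
      finally show ?thesis .
    qed (simp add: B_def)
  qed
  have "{..<L} \<subseteq> (\<Union>vw\<in>W \<times> W. B vw)"
  proof
    fix b assume "b \<in> {..<L}"
    then obtain v w where "v \<in> W" "w \<in> W" "v \<noteq> w" "poly (q v) (lam b) = poly (q w) (lam b)"
      using no by (auto simp: inj_on_def)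
    then have "b \<in> B (v, w)" using \<open>b \<in> {..<L}\<close> by (simp add: B_def)
    then show "b \<in> (\<Union>vw\<in>W \<times> W. B vw)" using \<open>v \<in> W\<close> \<open>w \<in> W\<close> by blast
  qed
  moreover have "finite (\<Union>vw\<in>W \<times> W. B vw)"
    using assms(1) by (auto simp: B_def)
  ultimately have "L \<le> card (\<Union>vw\<in>W \<times> W. B vw)" 
    using card_mono[of "\<Union>vw\<in>W \<times> W. B vw" "{..<L}"] by simp
  also have "\<dots> \<le> (\<Sum>vw\<in>W \<times> W. card (B vw))" using assms(1) by (intro card_UN_le) auto
  also have "\<dots> \<le> (\<Sum>vw\<in>W \<times> W. m)" by (intro sum_mono small)
  also have "\<dots> = card W * card W * m" using assms(1) by (simp add: card_cartesian_product)
  finally show False using assms(5) by simp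
qed

text \<open>By Newton interpolation, since \<open>acl S\<close> is a field.\<close>

lemma coeff_in_acl:
  fixes p :: "'a::alg_closed_field poly"
  assumes "finite T" "T \<subseteq> acl S" "\<And>t. t \<in> T \<Longrightarrow> poly p t \<in> acl S" "p = 0 \<or> degree p < card T"
  shows "coeff p j \<in> acl S"
  using assms
proof (induction T arbitrary: p j)
  case empty
  then show ?case by (simp add: acl_0)
next
  case (insert t T)
  define c where "c = poly p t"
  have "poly (p - [:c:]) t = 0" by (simp add: c_def)
  then obtain q where q: "p - [:c:] = [:-t, 1:] * q" by (metis dvdE poly_eq_0_iff_dvd)
  then have p: "p = [:c:] + [:-t, 1:] * q" by (simp add: algebra_simps)
  have c: "c \<in> acl S" and t: "t \<in> acl S" using insert.prems by (auto simp: c_def)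
  have coeffs: "coeff q j \<in> acl S" for j
  proof (rule insert.IH)
    show "T \<subseteq> acl S" using insert.prems by auto
    show "poly q z \<in> acl S" if "z \<in> T" for z
    proof -
      have "z - t \<noteq> 0" using that insert.hyps by auto
      moreover have "poly p z = c + (z - t) * poly q z" unfolding p by (simp add: left_diff_distrib)
      ultimately have "poly q z = (poly p z - c) / (z - t)" by (simp add: field_simps)
      moreover have "(poly p z - c) / (z - t) \<in> acl S"
        using insert.prems that c t by (intro acl_divide acl_diff) auto
      ultimately show ?thesis by simp
    qed
    show "q = 0 \<or> degree q < card T"
    proof (cases "q = 0")
      case False
      have "degree ([:-t, 1:] * q) = 1 + degree q" using False by (subst degree_mult_eq) auto
      moreover have "degree (p - [:c:]) \<le> degree p" by (rule degree_diff_le) auto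
      ultimately have "1 + degree q \<le> degree p" using q by simp
      moreover have "p = 0 \<or> degree p < Suc (card T)" using insert.prems(3) insert.hyps by simp
      ultimately show ?thesis by auto
    qed simp
  qed
  have "coeff p j = coeff [:c:] j + ((if j = 0 then 0 else coeff q (j - 1)) - t * coeff q j)"
    unfolding p by (cases j) (simp_all add: algebra_simps)
  moreover have "coeff [:c:] j \<in> acl S" using c acl_0 by (cases j) auto
  ultimately show ?case using coeffs t by (auto intro!: acl_add acl_diff acl_mult acl_0)
qed

lemma acl_indep_antimono: "acl_indep R xs \<Longrightarrow> R' \<subseteq> R \<Longrightarrow> acl_indep R' xs"
proof (induction xs arbitrary: R R')
  case (Cons x xs)
  then show ?case using acl_mono[of R' R] Cons.IH[of "insert x R" "insert x R'"] by auto
qed simp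

lemma MOST_imp_ex_acl_indep:
  fixes R :: "'a::alg_closed_field set"
  assumes "uncountable (UNIV :: 'a set)" "countable R" "MOST x. Q x"
  shows "\<exists>ts. length ts = m \<and> (\<forall>t\<in>set ts. Q t) \<and> acl_indep R ts"
  using assms(2)
proof (induction m arbitrary: R)
  case (Suc m)
  obtain t where "t \<notin> acl R" "Q t" using MOST_imp_ex_not_acl[OF assms(1) Suc.prems assms(3)] by blast
  moreover obtain ts where "length ts = m" "\<forall>t\<in>set ts. Q t" "acl_indep (insert t R) ts"
    using Suc.IH[of "insert t R"] Suc.prems by auto
  ultimately show ?case by (intro exI[of _ "t # ts"]) auto
qed simp

definition agree_off :: "'v set \<Rightarrow> ('v \<Rightarrow> 'a) \<Rightarrow> ('v \<Rightarrow> 'a) \<Rightarrow> bool" where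
  "agree_off V e z \<longleftrightarrow> (\<forall>v. v \<notin> V \<longrightarrow> z v = e v)"

lemma agree_off_empty: "agree_off {} e z \<longleftrightarrow> z = e"
  by (auto simp: agree_off_def)

lemma definable_ex_finite:
  fixes P :: "('v \<Rightarrow> 'a::alg_closed_field) \<Rightarrow> bool"
  assumes "finite V" "P \<in> definable"
  shows "(\<lambda>e. \<exists>z. agree_off V e z \<and> P z) \<in> definable"
  using assms(1)
proof (induction V)
  case empty
  then show ?case using assms(2) by (simp add: agree_off_empty)
next
  case (insert v V)
  have "(\<exists>z. agree_off (insert v V) e z \<and> P z) \<longleftrightarrow> (\<exists>x z. agree_off V (e(v := x)) z \<and> P z)" for e
  proof
    assume "\<exists>z. agree_off (insert v V) e z \<and> P z"
    then obtain z where "agree_off (insert v V) e z" "P z" by blast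
    then have "agree_off V (e(v := z v)) z \<and> P z" by (auto simp: agree_off_def)
    then show "\<exists>x z. agree_off V (e(v := x)) z \<and> P z" by blast
  next
    assume "\<exists>x z. agree_off V (e(v := x)) z \<and> P z"
    then obtain x z where "agree_off V (e(v := x)) z" "P z" by blast
    then have "agree_off (insert v V) e z \<and> P z" by (auto simp: agree_off_def)
    then show "\<exists>z. agree_off (insert v V) e z \<and> P z" by blast
  qed
  then show ?case using definable_ex[OF insert.IH, of v] by presburger
qed

definition infinite_in :: "'v set \<Rightarrow> (('v \<Rightarrow> 'a) \<Rightarrow> bool) \<Rightarrow> ('v \<Rightarrow> 'a) \<Rightarrow> bool" where
  "infinite_in V P e \<longleftrightarrow> (\<exists>v\<in>V. MOST x. \<exists>z. agree_off (V - {v}) (e(v := x)) z \<and> P z)"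

lemma definable_infinite_in:
  fixes P :: "('v \<Rightarrow> 'a::alg_closed_field) \<Rightarrow> bool"
  assumes "finite V" "P \<in> definable"
  shows "infinite_in V P \<in> definable"
  unfolding infinite_in_def[abs_def] using assms
  by (intro definable_bex definable_MOST[where P = "\<lambda>e. \<exists>z. agree_off (V - {_}) e z \<and> P z"]
      definable_ex_finite) auto

lemma not_infinite_in_bound:
  fixes P :: "('v \<Rightarrow> 'a::alg_closed_field) \<Rightarrow> bool"
  assumes "finite V" "P \<in> definable"
  shows "\<exists>C. \<forall>e. \<not> infinite_in V P e \<longrightarrow>
    finite {z. agree_off V e z \<and> P z} \<and> card {z. agree_off V e z \<and> P z} \<le> C"
proof -
  let ?Q = "\<lambda>v e x. \<exists>z. agree_off (V - {v}) (e(v := x)) z \<and> P z"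
  have "\<exists>N. \<forall>e. \<not> (MOST x. ?Q v e x) \<longrightarrow> finite {x. ?Q v e x} \<and> card {x. ?Q v e x} \<le> N" for v
    by (rule definable_fibre_bound[OF definable_ex_finite[OF _ assms(2)]]) (use assms(1) in simp)
  then have "\<exists>N. \<forall>v e. \<not> (MOST x. ?Q v e x) \<longrightarrow> finite {x. ?Q v e x} \<and> card {x. ?Q v e x} \<le> N v"
    by (rule choice[OF allI])
  then obtain N where N: "\<And>v e. \<not> (MOST x. ?Q v e x) \<Longrightarrow> finite {x. ?Q v e x} \<and> card {x. ?Q v e x} \<le> N v"
    by blast
  show ?thesis
  proof (intro exI[of _ "\<Prod>v\<in>V. N v"] allI impI)
    fix e assume e: "\<not> infinite_in V P e"
    let ?Z = "{z. agree_off V e z \<and> P z}" and ?R = "\<lambda>z. restrict z V"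
    have NV: "finite {x. ?Q v e x}" "card {x. ?Q v e x} \<le> N v" if "v \<in> V" for v
      using N[of v e] e that unfolding infinite_in_def by blast+
    have inj: "inj_on ?R ?Z"
    proof (rule inj_onI)
      fix z z' assume z: "z \<in> ?Z" "z' \<in> ?Z" "?R z = ?R z'"
      show "z = z'"
      proof
        fix v
        have "?R z v = ?R z' v" using z(3) by simp
        then show "z v = z' v" using z(1,2) by (cases "v \<in> V") (auto simp: agree_off_def)
      qed
    qed
    have sub: "?R ` ?Z \<subseteq> (\<Pi>\<^sub>E v\<in>V. {x. ?Q v e x})"
    proof (intro image_subsetI PiE_I)
      fix z v assume z: "z \<in> ?Z" "v \<in> V"
      then have "agree_off (V - {v}) (e(v := z v)) z" by (auto simp: agree_off_def)
      then show "?R z v \<in> {x. ?Q v e x}" using z by auto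
    qed auto
    have fin: "finite (\<Pi>\<^sub>E v\<in>V. {x. ?Q v e x})" by (rule finite_PiE[OF assms(1) NV(1)])
    then have fZ: "finite (?R ` ?Z)" using sub finite_subset by blast
    have "card ?Z = card (?R ` ?Z)" by (rule card_image[OF inj, symmetric])
    also have "\<dots> \<le> card (\<Pi>\<^sub>E v\<in>V. {x. ?Q v e x})" by (rule card_mono[OF fin sub])
    also have "\<dots> = (\<Prod>v\<in>V. card {x. ?Q v e x})" by (rule card_PiE[OF assms(1)])
    also have "\<dots> \<le> (\<Prod>v\<in>V. N v)" by (rule prod_mono) (use NV in auto)
    finally show "finite ?Z \<and> card ?Z \<le> (\<Prod>v\<in>V. N v)"
      using finite_imageD[OF fZ inj] by blast
  qed
qed

section \<open>The random algebraic graph\<close>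

datatype var = Coef nat nat nat nat | Lam nat | Pt nat nat

instance var :: countable
  by countable_datatype

text \<open>The weight is symmetric in \<open>p\<close> and \<open>q\<close>, so the forms below depend only on the unordered
  pair; a suitable choice of \<open>t\<close> and \<open>t'\<close> gives distinct weights to any boundedly many pairs,
  which makes the values of a random form at these pairs independent.\<close>

definition lin_form :: "nat \<Rightarrow> 'a::comm_ring_1 \<Rightarrow> (nat \<Rightarrow> 'a) \<Rightarrow> 'a" where
  "lin_form k t p = (\<Sum>l<k. p l * t ^ l)"

definition weight :: "nat \<Rightarrow> 'a::comm_ring_1 \<Rightarrow> 'a \<Rightarrow> (nat \<Rightarrow> 'a) \<Rightarrow> (nat \<Rightarrow> 'a) \<Rightarrow> 'a" where
  "weight k t t' p q = (t' - lin_form k t p) * (t' - lin_form k t q)"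

definition edge_form ::
  "nat \<Rightarrow> nat \<Rightarrow> nat \<Rightarrow> (var \<Rightarrow> 'a::comm_ring_1) \<Rightarrow> nat \<Rightarrow> (nat \<Rightarrow> 'a) \<Rightarrow> (nat \<Rightarrow> 'a) \<Rightarrow> 'a" where
  "edge_form k L d e r p q = (\<Sum>(a, b, j) \<in> {..<L} \<times> {..<L} \<times> {..<d}.
     e (Coef r a b j) * weight k (e (Lam a)) (e (Lam b)) p q ^ j)"

definition adjacent ::
  "nat \<Rightarrow> nat \<Rightarrow> nat \<Rightarrow> (var \<Rightarrow> 'a::comm_ring_1) \<Rightarrow> (nat \<Rightarrow> 'a) \<Rightarrow> (nat \<Rightarrow> 'a) \<Rightarrow> bool" where
  "adjacent k L d e p q \<longleftrightarrow> (\<forall>r\<in>{..<k - 1}. edge_form k L d e r p q = 0)"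

abbreviation vert :: "(var \<Rightarrow> 'a) \<Rightarrow> nat \<Rightarrow> nat \<Rightarrow> 'a" where
  "vert e i \<equiv> \<lambda>l. e (Pt i l)"

definition is_path :: "nat \<Rightarrow> nat \<Rightarrow> nat \<Rightarrow> (var \<Rightarrow> 'a::comm_ring_1) \<Rightarrow> bool" where
  "is_path k L d e \<longleftrightarrow> (\<forall>i\<in>{..<k}. adjacent k L d e (vert e i) (vert e (Suc i)))
     \<and> (\<forall>i\<in>{..k}. \<forall>j\<in>{..k} - {i}. \<exists>l\<in>{..<k}. e (Pt i l) \<noteq> e (Pt j l))"

definition coef_vars :: "nat \<Rightarrow> nat \<Rightarrow> nat \<Rightarrow> var set" where
  "coef_vars k L d = (\<lambda>(r, a, b, j). Coef r a b j) ` ({..<k - 1} \<times> {..<L} \<times> {..<L} \<times> {..<d})"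

definition inner_vars :: "nat \<Rightarrow> var set" where
  "inner_vars k = (\<lambda>(i, l). Pt i l) ` ({1..<k} \<times> {..<k})"

lemma Coef_in_coef_vars [simp]:
  "Coef r a b j \<in> coef_vars k L d \<longleftrightarrow> r < k - 1 \<and> a < L \<and> b < L \<and> j < d"
  by (auto simp: coef_vars_def image_iff)

lemma finite_coef_vars: "finite (coef_vars k L d)"
  by (simp add: coef_vars_def)

lemma card_coef_vars: "card (coef_vars k L d) = (k - 1) * (L * (L * d))"
  unfolding coef_vars_def by (subst card_image) (auto simp: inj_on_def card_cartesian_product)

lemma finite_inner_vars: "finite (inner_vars k)"
  by (simp add: inner_vars_def)

lemma weight_commute: "weight k t t' p q = weight k t t' q p"
  by (simp add: weight_def mult.commute)

lemma edge_form_commute: "edge_form k L d e r p q = edge_form k L d e r q p"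
  unfolding edge_form_def by (simp add: weight_commute)

lemma adjacent_commute: "adjacent k L d e p q \<longleftrightarrow> adjacent k L d e q p"
  unfolding adjacent_def by (simp add: edge_form_commute)

lemma edge_form_cong:
  assumes "\<And>r a b j. e (Coef r a b j) = e' (Coef r a b j)" "\<And>a. e (Lam a) = e' (Lam a)"
    "\<And>l. l < k \<Longrightarrow> p l = p' l" "\<And>l. l < k \<Longrightarrow> q l = q' l"
  shows "edge_form k L d e r p q = edge_form k L d e' r p' q'"
  using assms unfolding edge_form_def weight_def lin_form_def by simp

lemma polyfun_lin_form:
  "(\<And>l. (\<lambda>e. p e l) \<in> polyfun) \<Longrightarrow> t \<in> polyfun \<Longrightarrow> (\<lambda>e. lin_form k (t e) (p e)) \<in> polyfun"
  unfolding lin_form_def by (intro polyfun_sum polyfun.mult polyfun_power)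

lemma polyfun_edge_form:
  assumes "\<And>l. (\<lambda>e. p e l) \<in> polyfun" "\<And>l. (\<lambda>e. q e l) \<in> polyfun"
  shows "(\<lambda>e. edge_form k L d e r (p e) (q e)) \<in> polyfun"
  unfolding edge_form_def weight_def case_prod_unfold
  by (intro polyfun_sum polyfun.mult polyfun_power polyfun.diff polyfun_lin_form polyfun.var assms)

lemma definable_is_path: "is_path k L d \<in> definable"
  unfolding is_path_def[abs_def] adjacent_def
  by (intro definable.conj definable_ball definable_bex definable.neg definable_eq definable.zero
      polyfun_edge_form polyfun.var) auto

abbreviation bad where
  "bad k L d \<equiv> infinite_in (inner_vars k) (is_path k L d)"

lemma definable_bad:
  "(bad k L d :: (var \<Rightarrow> 'a::alg_closed_field) \<Rightarrow> bool) \<in> definable"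
  by (intro definable_infinite_in finite_inner_vars definable_is_path)

lemma lin_form_poly: "lin_form k t p = poly (\<Sum>l<k. monom (p l) l) t"
  by (simp add: lin_form_def poly_sum poly_monom)

lemma weight_in_acl:
  assumes "t \<in> acl S" "t' \<in> acl S" "\<And>l. l < k \<Longrightarrow> p l \<in> acl S" "\<And>l. l < k \<Longrightarrow> q l \<in> acl S"
  shows "weight k t t' p q \<in> acl S"
  unfolding weight_def lin_form_def
  by (intro acl_mult acl_diff acl_sum acl_power assms) (use assms in auto)

lemma ex_separating_pair:
  fixes lam :: "nat \<Rightarrow> 'a::idom"
  assumes "finite W" "\<And>p l. p \<in> W \<Longrightarrow> k \<le> l \<Longrightarrow> p l = 0"
    "finite E" "\<And>ed. ed \<in> E \<Longrightarrow> ed \<subseteq> W \<and> card ed = 2"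
    "inj_on lam {..<L}" "card W * card W * k < L" "card E * card E * 2 < L"
  shows "\<exists>a<L. \<exists>b<L. inj_on (\<lambda>ed. \<Prod>p\<in>ed. lam b - lin_form k (lam a) p) E"
proof -
  let ?q = "\<lambda>p. \<Sum>l<k. monom (p l) l :: 'a poly"
  have co: "coeff (?q p) l = (if l < k then p l else 0)" for p l
    by (simp add: coeff_sum)
  have "inj_on ?q W"
  proof (rule inj_onI)
    fix p p' assume p: "p \<in> W" "p' \<in> W" "?q p = ?q p'"
    show "p = p'"
    proof
      fix l
      show "p l = p' l" using co[of p l] co[of p' l] p(3) assms(2)[OF p(1), of l]
          assms(2)[OF p(2), of l] by (cases "l < k") auto
    qed
  qed
  moreover have "degree (?q p) \<le> k" for p
    by (rule degree_le) (simp add: co)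
  ultimately obtain a where a: "a < L" "inj_on (\<lambda>p. poly (?q p) (lam a)) W"
    using ex_separating_value[OF assms(1) _ _ assms(5,6), of ?q] by blast
  define h where "h p = lin_form k (lam a) p" for p
  have h: "inj_on h W" using a(2) by (simp add: h_def[abs_def] lin_form_poly)
  let ?m = "\<lambda>ed. \<Prod>p\<in>ed. [:- h p, 1:]"
  have "inj_on ?m E"
  proof (rule inj_onI)
    fix ed ed' assume e: "ed \<in> E" "ed' \<in> E" "?m ed = ?m ed'"
    have fin: "finite ed" "finite ed'" using assms(4)[OF e(1)] assms(4)[OF e(2)] by (auto intro: card_ge_0_finite)
    have roots: "{x. poly (?m ed) x = 0} = h ` ed" if "finite ed" for ed
      using that by (auto simp: poly_prod)
    have "h ` ed = h ` ed'" using roots[OF fin(1)] roots[OF fin(2)] e(3) by simp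
    then show "ed = ed'" using inj_on_image_eq_iff[OF h, of ed ed'] assms(4) e(1,2) by blast
  qed
  moreover have "degree (?m ed) \<le> 2" if "ed \<in> E" for ed
    using assms(4)[OF that] by (subst degree_prod_eq_sum_degree) auto
  ultimately obtain b where b: "b < L" "inj_on (\<lambda>ed. poly (?m ed) (lam b)) E"
    using ex_separating_value[OF assms(3) _ _ assms(5,7), of ?m] by blast
  have "poly (?m ed) (lam b) = (\<Prod>p\<in>ed. lam b - lin_form k (lam a) p)" for ed
    by (simp add: poly_prod h_def)
  then have "inj_on (\<lambda>ed. \<Prod>p\<in>ed. lam b - lin_form k (lam a) p) E" using b(2) by simp
  then show ?thesis using a(1) b(1) by blast
qed

text \<open>The key step. At a generic bad coefficient vector, of transcendence degree more than
  \<open>card (coef_vars k L d) - s\<close> over the end points, the infinite family of paths contributes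
  \<open>s\<close> further independent coordinates. But each edge of the union of these paths determines
  \<open>k - 1\<close> of the coefficients, and the union has enough edges to pay for its inner vertices.\<close>

theorem bad_dim:
  fixes e :: "var \<Rightarrow> 'a::alg_closed_field"
  assumes unc: "uncountable (UNIV :: 'a set)" and k: "k \<ge> 2" and s: "s \<ge> 1"
    and d: "d = s * k" and L: "L = (s * k + 2)\<^sup>2 * k + 1"
    and lam: "inj_on (\<lambda>a. e (Lam a)) {..<L}"
    and vs: "set vs = coef_vars k L d" "distinct vs"
    and n: "n = card (coef_vars k L d) - s + 1"
  shows "\<not> dim_ge vs n (bad k L d) e"
proof
  let ?A = "coef_vars k L d" and ?I = "inner_vars k" and ?S = "range e"
  assume "dim_ge vs n (bad k L d) e"
  then obtain e1 ws where e1: "\<forall>v. v \<notin> ?A \<longrightarrow> e1 v = e v" and bad: "bad k L d e1"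
    and ws: "set ws \<subseteq> ?A" "length ws = n" "acl_indep ?S (map e1 ws)"
    using dim_ge_generic[OF unc _ vs(2), of ?S n "bad k L d" e] vs(1) by auto
  obtain v where v: "v \<in> ?I"
    and most: "MOST x. \<exists>z. agree_off (?I - {v}) (e1(v := x)) z \<and> is_path k L d z"
    using bad unfolding infinite_in_def by blast
  obtain ts where ts: "length ts = s" "acl_indep (range e1 \<union> ?S) ts"
    "\<forall>t\<in>set ts. \<exists>z. agree_off (?I - {v}) (e1(v := t)) z \<and> is_path k L d z"
    using MOST_imp_ex_acl_indep[OF unc _ most, of "range e1 \<union> ?S" s] by auto
  then obtain g where g: "\<And>t. t \<in> set ts \<Longrightarrow> agree_off (?I - {v}) (e1(v := t)) (g t)"
    "\<And>t. t \<in> set ts \<Longrightarrow> is_path k L d (g t)" by metis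
  have g_off: "g t u = e1 u" if "t \<in> set ts" "u \<notin> ?I" for t u
    using g(1)[OF that(1)] that(2) v by (auto simp: agree_off_def)
  have g_v: "g t v = t" if "t \<in> set ts" for t
    using g(1)[OF that] by (auto simp: agree_off_def)
  have indep: "acl_indep ?S (map e1 ws @ ts)"
    unfolding acl_indep_append using ws(3)
    by (intro conjI acl_indep_antimono[OF ts(2)]) auto
  obtain i0 l0 where v_eq: "v = Pt i0 l0" "i0 \<in> {1..<k}" "l0 < k"
    using v by (auto simp: inner_vars_def)
  define path where "path t i = (\<lambda>l. if l < k then g t (Pt i l) else 0)" for t i
  define T where "T = path ` set ts"
  define x y where "x = (\<lambda>l. if l < k then e (Pt 0 l) else 0)"
    and "y = (\<lambda>l. if l < k then e (Pt k l) else 0)"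
  have ends: "g t (Pt 0 l) = e (Pt 0 l)" "g t (Pt k l) = e (Pt k l)" if "t \<in> set ts" for t l
  proof -
    have "Pt 0 l \<notin> ?I" "Pt k l \<notin> ?I" "Pt 0 l \<notin> ?A" "Pt k l \<notin> ?A"
      by (auto simp: inner_vars_def coef_vars_def)
    then show "g t (Pt 0 l) = e (Pt 0 l)" "g t (Pt k l) = e (Pt k l)"
      using g_off[OF that] e1 by simp_all
  qed
  have finT: "finite T" and cT: "card T \<le> s"
    using ts(1) card_image_le[of "set ts" path] card_length[of ts] by (auto simp: T_def)
  have inj_path: "inj_on (path t) {..k}" if t: "t \<in> set ts" for t
  proof (rule inj_onI, rule ccontr)
    fix i j assume ij: "i \<in> {..k}" "j \<in> {..k}" "path t i = path t j" "i \<noteq> j"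
    then obtain l where "l < k" "g t (Pt i l) \<noteq> g t (Pt j l)"
      using g(2)[OF t] unfolding is_path_def by blast
    then show False using fun_cong[OF ij(3), of l] by (simp add: path_def)
  qed
  have T: "inj_on p {..k} \<and> p 0 = x \<and> p k = y" if "p \<in> T" for p
    using that inj_path ends by (auto simp: T_def path_def x_def y_def)
  define U where "U = inner_verts k T"
  define E where "E = path_edges k T"
  define W where "W = U \<union> {x, y}"
  have fin: "finite U" "finite E" "finite W"
    using finT by (auto simp: U_def E_def W_def finite_inner_verts finite_path_edges)
  have UE: "k * card U \<le> (k - 1) * card E"
    unfolding U_def E_def using inner_verts_le_path_edges[OF finT _ T] k by auto
  have cE: "card E \<le> d"
    unfolding E_def d by (rule le_trans[OF card_path_edges_le[OF finT] mult_le_mono1[OF cT]])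
  have cW: "card W \<le> s * k + 2"
  proof -
    have "card W \<le> card U + card {x, y}" unfolding W_def by (rule card_Un_le)
    moreover have "card {x, y} \<le> 2" by (cases "x = y") auto
    moreover have "card U \<le> s * (k - 1)"
      unfolding U_def by (rule le_trans[OF card_inner_verts_le[OF finT] mult_le_mono1[OF cT]])
    moreover have "s * (k - 1) \<le> s * k" by simp
    ultimately show ?thesis by linarith
  qed
  have path_W: "p i \<in> W" if "p \<in> T" "i \<le> k" for p i
  proof -
    consider "i = 0" | "i = k" | "i \<in> {1..<k}" using \<open>i \<le> k\<close> by fastforce
    then show ?thesis
    proof cases
      case 3
      then show ?thesis using \<open>p \<in> T\<close> unfolding W_def U_def inner_verts_def by blast
    qed (use T[OF \<open>p \<in> T\<close>] in \<open>auto simp: W_def\<close>)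
  qed
  have W0: "p l = 0" if "p \<in> W" "k \<le> l" for p l
    using that by (auto simp: W_def U_def inner_verts_def T_def path_def x_def y_def)
  have EE: "\<exists>t i. t \<in> set ts \<and> i < k \<and> ed = {path t i, path t (Suc i)} \<and> path t i \<noteq> path t (Suc i)"
    if "ed \<in> E" for ed
  proof -
    obtain t i where ti: "t \<in> set ts" "i < k" "ed = {path t i, path t (Suc i)}"
      using \<open>ed \<in> E\<close> by (auto simp: E_def path_edges_def T_def)
    then have "path t i \<noteq> path t (Suc i)" using inj_onD[OF inj_path[OF ti(1)], of i "Suc i"] by auto
    then show ?thesis using ti by blast
  qed
  have EW: "ed \<subseteq> W \<and> card ed = 2" if "ed \<in> E" for ed
  proof -
    obtain t i where ti: "t \<in> set ts" "i < k" "ed = {path t i, path t (Suc i)}"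
      "path t i \<noteq> path t (Suc i)" using EE[OF \<open>ed \<in> E\<close>] by blast
    then show ?thesis using path_W[of "path t" i] path_W[of "path t" "Suc i"] by (auto simp: T_def)
  qed
  have "card W * card W * k < L"
    unfolding L power2_eq_square using mult_le_mono1[OF mult_le_mono[OF cW cW], of k] by simp
  moreover have "card E * card E * 2 < L"
  proof -
    have "card E \<le> s * k + 2" using cE d by simp
    then have "card E * card E * 2 \<le> (s * k + 2) * (s * k + 2) * k"
      using k by (intro mult_le_mono) auto
    then show ?thesis unfolding L power2_eq_square by simp
  qed
  ultimately obtain a b where ab: "a < L" "b < L"
    "inj_on (\<lambda>ed. \<Prod>p\<in>ed. e (Lam b) - lin_form k (e (Lam a)) p) E"
    using ex_separating_pair[of W k E "\<lambda>a. e (Lam a)" L] fin W0 EW lam by metis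
  define \<phi> where "\<phi> ed = (\<Prod>p\<in>ed. e (Lam b) - lin_form k (e (Lam a)) p)" for ed
  define A1 where "A1 = (\<lambda>(r, j). Coef r a b j) ` ({..<k - 1} \<times> {..<card E})"
  have A1: "A1 \<subseteq> ?A" "card A1 = (k - 1) * card E"
  proof -
    show "A1 \<subseteq> ?A" using ab cE by (auto simp: A1_def)
    show "card A1 = (k - 1) * card E"
      unfolding A1_def by (subst card_image) (auto simp: inj_on_def card_cartesian_product)
  qed
  define G where "G = (\<lambda>(p, l). p l) ` (U \<times> {..<k}) \<union> e1 ` (?A - A1)"
  have finG: "finite G" using fin finite_coef_vars by (simp add: G_def)
  have cG: "card G \<le> card ?A"
  proof -
    have "card G \<le> card ((\<lambda>(p, l). p l) ` (U \<times> {..<k})) + card (e1 ` (?A - A1))"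
      unfolding G_def by (rule card_Un_le)
    moreover have "card ((\<lambda>(p, l). p l) ` (U \<times> {..<k})) \<le> card U * k"
      using card_image_le[of "U \<times> {..<k}" "\<lambda>(p, l). p l"] fin by (simp add: card_cartesian_product)
    moreover have "card (e1 ` (?A - A1)) \<le> card (?A - A1)"
      by (rule card_image_le) (simp add: finite_coef_vars)
    moreover have "card (?A - A1) = card ?A - (k - 1) * card E"
      using A1 finite_subset[OF A1(1) finite_coef_vars] by (subst card_Diff_subset) auto
    moreover have "(k - 1) * card E \<le> card ?A"
      using A1 card_mono[OF finite_coef_vars, of A1] by simp
    ultimately show ?thesis using UE by (simp add: mult.commute)
  qed
  let ?K = "acl (G \<union> ?S)"
  have GK: "G \<union> ?S \<subseteq> ?K" by (rule acl_superset)
  have WK: "p l \<in> ?K" if "p \<in> W" "l < k" for p l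
  proof -
    have "p l \<in> G \<union> ?S"
      using that by (auto simp: W_def x_def y_def G_def intro!: image_eqI[where x = "(p, l)"])
    then show ?thesis using GK by blast
  qed
  have LK: "e (Lam c) \<in> ?K" for c using GK by blast
  have weightK: "weight k (e (Lam a')) (e (Lam b')) p q \<in> ?K" if "p \<in> W" "q \<in> W" for a' b' p q
    by (rule weight_in_acl[OF LK LK WK[OF \<open>p \<in> W\<close>] WK[OF \<open>q \<in> W\<close>]])
  have e1K: "e1 u \<in> ?K" if "u \<in> ?A - A1" for u
    using that GK by (auto simp: G_def)
  have e1Lam: "e1 (Lam c) = e (Lam c)" for c
    using e1 by (auto simp: coef_vars_def)
  have \<phi>_weight: "\<phi> {p, q} = weight k (e (Lam a)) (e (Lam b)) p q" if "p \<noteq> q" for p q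
    using that by (simp add: \<phi>_def weight_def)
  have coefK: "e1 (Coef r a b j) \<in> ?K" if r: "r < k - 1" and j: "j < card E" for r j
  proof -
    define p where "p = (\<Sum>j<card E. monom (e1 (Coef r a b j)) j)"
    have co: "coeff p j = (if j < card E then e1 (Coef r a b j) else 0)" for j
      by (simp add: p_def coeff_sum)
    have "coeff p j \<in> ?K"
    proof (rule coeff_in_acl)
      show "finite (\<phi> ` E)" using fin by simp
      show "\<phi> ` E \<subseteq> ?K"
      proof (rule image_subsetI)
        fix ed assume "ed \<in> E"
        then obtain t i where ti: "t \<in> set ts" "i < k" "ed = {path t i, path t (Suc i)}"
          "path t i \<noteq> path t (Suc i)" using EE by blast
        then show "\<phi> ed \<in> ?K" using path_W[of "path t" i] path_W[of "path t" "Suc i"]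
          by (simp add: T_def \<phi>_weight weightK)
      qed
      have "card (\<phi> ` E) = card E"
        using ab(3) by (intro card_image) (simp add: \<phi>_def[abs_def])
      moreover have "degree p < card E" if "p \<noteq> 0"
      proof -
        have "coeff p (degree p) \<noteq> 0" using that by simp
        then show ?thesis unfolding co by (metis)
      qed
      ultimately show "p = 0 \<or> degree p < card (\<phi> ` E)" by auto
      fix z assume "z \<in> \<phi> ` E"
      then obtain ed where ed: "ed \<in> E" "z = \<phi> ed" by blast
      then obtain t i where ti: "t \<in> set ts" "i < k" "ed = {path t i, path t (Suc i)}"
          "path t i \<noteq> path t (Suc i)" using EE by blast
      let ?p = "path t i" and ?q = "path t (Suc i)"
      have pq: "?p \<in> W" "?q \<in> W" using ti path_W[of "path t"] by (auto simp: T_def)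
      have z: "z = weight k (e (Lam a)) (e (Lam b)) ?p ?q" using ti ed \<phi>_weight by simp
      let ?f = "\<lambda>(a, b, j). e1 (Coef r a b j) * weight k (e (Lam a)) (e (Lam b)) ?p ?q ^ j"
      let ?J = "{..<L} \<times> {..<L} \<times> {..<d}" and ?J1 = "{a} \<times> {b} \<times> {..<card E}"
      have "g t (Coef r a b j) = e1 (Coef r a b j)" "g t (Lam a) = e1 (Lam a)" for r a b j
        by (rule g_off[OF ti(1)]; force simp: inner_vars_def)+
      then have "edge_form k L d e1 r ?p ?q = edge_form k L d (g t) r (vert (g t) i) (vert (g t) (Suc i))"
        by (intro edge_form_cong) (auto simp: path_def)
      also have "\<dots> = 0"
        using g(2)[OF ti(1)] ti(2) r unfolding is_path_def adjacent_def by blast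
      finally have "sum ?f ?J = 0" by (simp add: edge_form_def e1Lam)
      moreover have "sum ?f ?J = sum ?f (?J - ?J1) + sum ?f ?J1"
        by (rule sum.subset_diff) (use ab cE in auto)
      moreover have "sum ?f ?J1 = poly p z"
        by (simp add: p_def poly_sum poly_monom z sum.cartesian_product[symmetric])
      ultimately have "poly p z = 0 - sum ?f (?J - ?J1)" by (simp add: eq_neg_iff_add_eq_0 add.commute)
      moreover have "sum ?f (?J - ?J1) \<in> ?K"
      proof (rule acl_sum)
        fix abj assume "abj \<in> ?J - ?J1"
        moreover obtain a' b' j' where [simp]: "abj = (a', b', j')" by (metis prod_cases3)
        ultimately have "Coef r a' b' j' \<in> ?A - A1" using r by (auto simp: A1_def)
        then show "?f abj \<in> ?K"
          using pq by (simp add: acl_mult acl_power weightK e1K)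
      qed
      ultimately show "poly p z \<in> ?K" by (simp only: acl_diff[OF acl_0])
    qed
    then show ?thesis using j by (simp add: co)
  qed
  have "set (map e1 ws @ ts) \<subseteq> ?K"
  proof -
    have "e1 u \<in> ?K" if "u \<in> ?A" for u
      using that e1K coefK by (cases "u \<in> A1") (auto simp: A1_def)
    moreover have "t \<in> ?K" if "t \<in> set ts" for t
    proof -
      have "path t i0 l0 = t" using g_v[OF that] v_eq by (simp add: path_def)
      moreover have "path t \<in> T" using that by (simp add: T_def)
      ultimately show ?thesis using WK[OF path_W[of "path t" i0], of l0] v_eq by simp
    qed
    ultimately show ?thesis using ws(1) by auto
  qed
  then have "length (map e1 ws @ ts) \<le> card G"
    by (rule acl_indep_length_le[OF finG _ indep])
  then have "n + s \<le> card ?A" using ws(2) ts(1) cG by simp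
  then show False using n by simp
qed

section \<open>Finite fields of characteristic two and transfer to graphs\<close>

text \<open>Algebraically closed of characteristic 2, so that it contains all the fields with \<open>2 ^ t\<close>
  elements, and uncountable, hence of infinite transcendence degree.\<close>

type_synonym dom = "bit fls alg_closure"

lemma uncountable_dom: "uncountable (UNIV :: dom set)"
proof
  assume "countable (UNIV :: dom set)"
  then obtain f :: "nat \<Rightarrow> dom" where f: "range f = UNIV"
    by (metis UNIV_not_empty range_from_nat_into)
  define h :: "nat set \<Rightarrow> dom"
    where "h A = to_ac (fps_to_fls (Abs_fps (\<lambda>n. if n \<in> A then 1 else 0)))" for A
  have h: "A = B" if "h A = h B" for A B
  proof -
    have "(if n \<in> A then 1 else 0 :: bit) = (if n \<in> B then 1 else 0)" for n
      using that by (simp add: h_def fps_eq_iff)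
    then have "n \<in> A \<longleftrightarrow> n \<in> B" for n by (metis zero_neq_one)
    then show ?thesis by blast
  qed
  define D where "D = {n. \<exists>A. f n = h A \<and> n \<notin> A}"
  obtain n where n: "f n = h D" using f by (metis rangeE UNIV_I)
  have "n \<in> D \<longleftrightarrow> (\<exists>A. f n = h A \<and> n \<notin> A)" by (simp add: D_def)
  then show False using h n by metis
qed

lemma two_eq_0_dom: "(2 :: dom) = 0"
proof -
  have "(2 :: bit fls) = fls_const 1 + fls_const 1" by simp
  also have "\<dots> = 0" unfolding fls_plus_const by simp
  finally have "to_ac (2 :: bit fls) = 0" by simp
  then show ?thesis by simp
qed

lemma frobenius_add_dom: "(x + y) ^ (2 ^ t) = x ^ (2 ^ t) + y ^ (2 ^ t)" for x y :: dom
proof (induction t)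
  case (Suc t)
  have "(x + y) ^ (2 ^ Suc t) = ((x + y) ^ (2 ^ t))\<^sup>2"
    by (simp only: power_Suc mult.commute[of 2] power_mult)
  also have "\<dots> = (x ^ (2 ^ t) + y ^ (2 ^ t))\<^sup>2" by (simp only: Suc)
  also have "\<dots> = (x ^ (2 ^ t))\<^sup>2 + (y ^ (2 ^ t))\<^sup>2"
    by (simp add: power2_sum two_eq_0_dom)
  finally show ?case by (simp add: mult.commute flip: power_mult)
qed simp

lemma card_roots_separable:
  fixes p :: "'a::alg_closed_field poly"
  assumes "p \<noteq> 0" "\<And>x. poly p x = 0 \<Longrightarrow> poly (pderiv p) x \<noteq> 0"
  shows "card {x. poly p x = 0} = degree p"
  using assms
proof (induction "degree p" arbitrary: p)
  case 0
  then obtain c where "p = [:c:]" by (metis degree_eq_zeroE)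
  then show ?case using 0 by simp
next
  case (Suc n)
  then obtain a where a: "poly p a = 0" using alg_closed_imp_poly_has_root[of p] by auto
  then obtain q where q: "p = [:-a, 1:] * q" by (metis dvdE poly_eq_0_iff_dvd)
  have q0: "q \<noteq> 0" using q Suc.prems by auto
  have "degree p = 1 + degree q" unfolding q using q0 by (subst degree_mult_eq) auto
  then have n: "n = degree q" using Suc.hyps by simp
  have pd: "pderiv p = [:-a, 1:] * pderiv q + q" unfolding q
    by (subst pderiv_mult) (simp add: pderiv_pCons)
  have "poly q a \<noteq> 0" using Suc.prems(2)[OF a] pd by simp
  moreover have "{x. poly p x = 0} = insert a {x. poly q x = 0}" unfolding q by auto
  moreover have "card {x. poly q x = 0} = degree q"
  proof (rule Suc.hyps(1)[OF n q0])
    fix x assume x: "poly q x = 0"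
    then have "poly p x = 0" unfolding q by simp
    then show "poly (pderiv q) x \<noteq> 0" using Suc.prems(2) pd x by fastforce
  qed
  ultimately show ?case using n Suc.hyps(2) poly_roots_finite[OF q0] by simp
qed

definition subfield2 :: "nat \<Rightarrow> dom set" where
  "subfield2 t = {x. x ^ (2 ^ t) = x}"

lemma card_subfield2:
  assumes "t \<ge> 1"
  shows "card (subfield2 t) = 2 ^ t"
proof -
  let ?q = "2 ^ t :: nat"
  define p :: "dom poly" where "p = monom 1 ?q - monom 1 1"
  have q: "?q > 1" using one_less_power[of "2 :: nat" t] assms by simp
  have co: "coeff p ?q = 1" using q by (simp add: p_def)
  have "degree p \<le> ?q"
    unfolding p_def by (rule degree_diff_le) (use q in \<open>auto intro: order_trans[OF degree_monom_le]\<close>)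
  then have deg: "degree p = ?q" using le_degree[of p ?q] co by simp
  have "of_nat ?q = (0 :: dom)" using assms by (simp add: two_eq_0_dom)
  then have "pderiv (monom (1 :: dom) ?q) = 0"
    unfolding pderiv_monom by (simp only: mult_zero_left monom_eq_0)
  moreover have "pderiv (monom (1 :: dom) 1) = 1"
    by (simp add: pderiv_monom one_pCons monom_0)
  ultimately have "pderiv p = - 1" by (simp add: p_def pderiv_diff)
  then have "card {x. poly p x = 0} = degree p"
    by (intro card_roots_separable) (use co in auto)
  then show ?thesis using deg by (simp add: subfield2_def p_def poly_monom)
qed

lemma subfield2_closed:
  "0 \<in> subfield2 t" "x \<in> subfield2 t \<Longrightarrow> y \<in> subfield2 t \<Longrightarrow> x + y \<in> subfield2 t"
  "x \<in> subfield2 t \<Longrightarrow> y \<in> subfield2 t \<Longrightarrow> x * y \<in> subfield2 t"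
  "x \<in> subfield2 t \<Longrightarrow> - x \<in> subfield2 t" "1 \<in> subfield2 t"
proof -
  have "- x = x" for x :: dom
    by (rule minus_unique) (simp add: two_eq_0_dom flip: mult_2)
  then show "x \<in> subfield2 t \<Longrightarrow> - x \<in> subfield2 t" by metis
qed (auto simp: subfield2_def frobenius_add_dom power_mult_distrib)

lemma extremal_number_ge:
  fixes G :: "'a sgraph"
  assumes G: "finite_simple_graph G" "card (verts G) \<le> n" and k: "k \<ge> 2" "l \<ge> 1"
    and free: "\<And>P x y. (\<And>i. i < l \<Longrightarrow> inj_on (P i) {..k} \<and> P i 0 = x \<and> P i k = y
        \<and> (\<forall>j<k. {P i j, P i (Suc j)} \<in> edges G)) \<Longrightarrow> inj_on (\<lambda>i. P i (1 :: nat)) {..<l} \<Longrightarrow> False"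
  shows "card (edges G) \<le> extremal_number n (theta k l)"
proof -
  have fin: "finite (verts G)" and E: "\<And>e. e \<in> edges G \<Longrightarrow> e \<subseteq> verts G \<and> card e = 2"
    using G(1) by (auto simp: finite_simple_graph_def)
  obtain h where h: "inj_on h (verts G)" "h ` verts G \<subseteq> {..<n}"
    using card_le_inj[OF fin finite_lessThan[of n]] G(2) by auto
  define N :: "nat sgraph" where "N = \<lparr>verts = {..<n}, edges = (`) h ` edges G\<rparr>"
  have "inj_on ((`) h) (edges G)"
    by (rule inj_onI) (metis E h(1) inj_on_image_eq_iff)
  then have cN: "card (edges N) = card (edges G)"
    by (simp add: N_def card_image)
  have N: "finite_simple_graph N"
  proof -
    have "card (h ` e) = 2" if "e \<in> edges G" for e
      using E[OF that] h(1) by (metis card_image inj_on_subset)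
    moreover have "h ` e \<subseteq> {..<n}" if "e \<in> edges G" for e
      using E[OF that] h(2) by blast
    ultimately show ?thesis by (simp add: finite_simple_graph_def N_def)
  qed
  have "\<not> contains_copy N (theta k l)"
  proof
    assume "contains_copy N (theta k l)"
    then obtain K f where K: "is_subgraph K N" and f: "bij_betw f (verts K) (verts (theta k l))"
      and iso: "\<forall>u \<in> verts K. \<forall>v \<in> verts K. {u, v} \<in> edges K \<longleftrightarrow> {f u, f v} \<in> edges (theta k l)"
      unfolding contains_copy_def isomorphic_def by blast
    define g where "g = inv_into (verts K) f"
    have g: "g u \<in> verts K" "f (g u) = u" if "u \<in> verts (theta k l)" for u
      using f that unfolding g_def by (auto simp: bij_betw_def inv_into_into f_inv_into_f)
    have tp: "theta_point k i j \<in> verts (theta k l)" if "i < l" "j \<le> k" for i j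
      using that by (auto simp: theta_def theta_point_def)
    define P where "P i j = inv_into (verts G) h (g (theta_point k i j))" for i j
    have edge: "{g (theta_point k i j), g (theta_point k i (Suc j))} \<in> (`) h ` edges G"
      if "i < l" "j < k" for i j
    proof -
      have "{theta_point k i j, theta_point k i (Suc j)} \<in> edges (theta k l)"
        using that by (auto simp: theta_def)
      then have "{g (theta_point k i j), g (theta_point k i (Suc j))} \<in> edges K"
        using iso g tp that by (metis Suc_leI less_imp_le)
      then show ?thesis using K by (auto simp: is_subgraph_def N_def)
    qed
    have hP: "P i j \<in> verts G" "h (P i j) = g (theta_point k i j)" if "i < l" "j \<le> k" for i j
    proof -
      obtain j' where j': "j' < k" "j = j' \<or> j = Suc j'"
      proof (cases j)
        case 0
        then show ?thesis using k by (intro that[of 0]) auto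
      next
        case (Suc j'')
        then show ?thesis using \<open>j \<le> k\<close> by (intro that[of j'']) auto
      qed
      then have "g (theta_point k i j) \<in> \<Union> ((`) h ` edges G)"
        using edge[OF \<open>i < l\<close> j'(1)] by blast
      then have "g (theta_point k i j) \<in> h ` verts G" using E by blast
      then show "P i j \<in> verts G" "h (P i j) = g (theta_point k i j)"
        unfolding P_def by (auto simp: inv_into_into f_inv_into_f)
    qed
    have Pinj: "theta_point k i j = theta_point k i' j'"
      if "P i j = P i' j'" "i < l" "i' < l" "j \<le> k" "j' \<le> k" for i j i' j'
    proof -
      have "g (theta_point k i j) = g (theta_point k i' j')" using hP that by metis
      then show ?thesis using g(2) tp that by metis
    qed
    show False
    proof (rule free)
      fix i assume i: "i < l"
      have "inj_on (P i) {..k}"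
      proof (rule inj_onI)
        fix j j' assume "j \<in> {..k}" "j' \<in> {..k}" "P i j = P i j'"
        then have "theta_point k i j = theta_point k i j'" by (intro Pinj) (use i in auto)
        then show "j = j'" by (auto simp: theta_point_def split: if_splits)
      qed
      moreover have "P i 0 = P 0 0" "P i k = P 0 k" by (auto simp: P_def theta_point_def)
      moreover have "{P i j, P i (Suc j)} \<in> edges G" if j: "j < k" for j
      proof -
        obtain e where e: "e \<in> edges G" "{g (theta_point k i j), g (theta_point k i (Suc j))} = h ` e"
          using edge[OF i j] by blast
        then have "h ` {P i j, P i (Suc j)} = h ` e" using hP i j by simp
        moreover have "{P i j, P i (Suc j)} \<subseteq> verts G" using hP i j by simp
        ultimately have "{P i j, P i (Suc j)} = e"
          using inj_on_image_eq_iff[OF h(1)] E[OF e(1)] by blast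
        then show ?thesis using e(1) by simp
      qed
      ultimately show "inj_on (P i) {..k} \<and> P i 0 = P 0 0 \<and> P i k = P 0 k
          \<and> (\<forall>j<k. {P i j, P i (Suc j)} \<in> edges G)" by blast
    next
      show "inj_on (\<lambda>i. P i 1) {..<l}"
      proof (rule inj_onI)
        fix i i' assume "i \<in> {..<l}" "i' \<in> {..<l}" "P i 1 = P i' 1"
        then have "theta_point k i 1 = theta_point k i' 1" by (intro Pinj) (use k in auto)
        then show "i = i'" using k by (simp add: theta_point_def)
      qed
    qed
  qed
  then have "card (edges N) \<in> edge_counts_avoiding n (theta k l)"
    unfolding edge_counts_avoiding_def using N by (intro CollectI exI[of _ N]) (simp add: N_def)
  then have "card (edges N) \<le> extremal_number n (theta k l)"
    unfolding extremal_number_def by (intro Max_ge finite_edge_counts_avoiding)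
  then show ?thesis by (simp add: cN)
qed

lemma card_points_True:
  assumes "finite V" "finite F"
  shows "card (points V F (\<lambda>_. True) e) = card F ^ card V"
  using assms(1)
proof (induction V arbitrary: e)
  case (insert v V)
  have "points V F (\<lambda>_. True) (e(v := x)) \<inter> points V F (\<lambda>_. True) (e(v := y)) = {}"
    if "x \<noteq> y" for x y
    using insert.hyps that by (auto simp: points_def)
  then have "card (points (insert v V) F (\<lambda>_. True) e)
      = (\<Sum>x\<in>F. card (points V F (\<lambda>_. True) (e(v := x))))"
    unfolding points_insert[OF insert.hyps(2)]
    by (intro card_UN_disjoint) (use assms(2) finite_points[OF insert.hyps(1) assms(2)] in auto)
  then show ?case using insert by simp
qed (simp add: points_empty)

lemma edge_form_in:
  fixes F :: "'a::comm_ring_1 set"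
  assumes F: "0 \<in> F" "1 \<in> F" "\<And>x y. x \<in> F \<Longrightarrow> y \<in> F \<Longrightarrow> x + y \<in> F"
    "\<And>x y. x \<in> F \<Longrightarrow> y \<in> F \<Longrightarrow> x * y \<in> F" "\<And>x. x \<in> F \<Longrightarrow> - x \<in> F"
    and c: "\<And>a b j. e (Coef r a b j) \<in> F" "\<And>a. e (Lam a) \<in> F"
    and p: "\<And>l. l < k \<Longrightarrow> p l \<in> F" "\<And>l. l < k \<Longrightarrow> q l \<in> F"
  shows "edge_form k L d e r p q \<in> F"
proof -
  have sum: "sum f A \<in> F" if "\<And>i. i \<in> A \<Longrightarrow> f i \<in> F" for f :: "'i \<Rightarrow> 'a" and A
    using that by (induction A rule: infinite_finite_induct) (auto intro: F)
  have sum3: "sum f A \<in> F" if "\<And>i. i \<in> A \<Longrightarrow> f i \<in> F" for f :: "nat \<times> nat \<times> nat \<Rightarrow> 'a" and A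
    using that by (induction A rule: infinite_finite_induct) (auto intro: F)
  have pow: "x ^ n \<in> F" if "x \<in> F" for x n
    using that by (induction n) (auto intro: F)
  have diff: "x - y \<in> F" if "x \<in> F" "y \<in> F" for x y
    using F(3)[OF that(1) F(5)[OF that(2)]] by simp
  have lin: "lin_form k (e (Lam a)) p \<in> F" "lin_form k (e (Lam a)) q \<in> F" for a
    unfolding lin_form_def using p by (induction k) (auto intro!: F pow c)
  show ?thesis
    unfolding edge_form_def
    by (rule sum3) (auto simp: weight_def intro!: F(4) pow diff lin c)
qed

lemma card_adjacent_ge:
  fixes F :: "'a::comm_ring_1 set" and k L d :: nat and e :: "var \<Rightarrow> 'a"
  defines "A \<equiv> coef_vars k L d"
  assumes F: "finite F" "0 \<in> F" "1 \<in> F" "\<And>x y. x \<in> F \<Longrightarrow> y \<in> F \<Longrightarrow> x + y \<in> F"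
    "\<And>x y. x \<in> F \<Longrightarrow> y \<in> F \<Longrightarrow> x * y \<in> F" "\<And>x. x \<in> F \<Longrightarrow> - x \<in> F"
    and Ld: "L \<ge> 1" "d \<ge> 1"
    and e: "\<And>r a b j. e (Coef r a b j) = 0" "\<And>a. e (Lam a) \<in> F"
    and p: "\<And>l. l < k \<Longrightarrow> p l \<in> F" "\<And>l. l < k \<Longrightarrow> q l \<in> F"
  shows "card F ^ (card A - (k - 1)) \<le> card {c \<in> points A F (\<lambda>_. True) e. adjacent k L d c p q}"
proof -
  define B where "B = (\<lambda>r. Coef r 0 0 0) ` {..<k - 1}"
  have B: "B \<subseteq> A" "card B = k - 1"
    using Ld by (auto simp: B_def A_def card_image inj_on_def)
  have finA: "finite A" unfolding A_def by (rule finite_coef_vars)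
  define \<Phi> where "\<Phi> c v = (case v of Coef r a b j \<Rightarrow>
      if v \<in> B then - edge_form k L d c r p q else c v | _ \<Rightarrow> c v)" for c v
  have \<Phi>B: "\<Phi> c (Coef r 0 0 0) = - edge_form k L d c r p q" if "r < k - 1" for c r
    using that by (auto simp: \<Phi>_def B_def)
  have \<Phi>nB: "\<Phi> c v = c v" if "v \<notin> B" for c v
    using that by (auto simp: \<Phi>_def split: var.split)
  let ?S = "points (A - B) F (\<lambda>_. True) e" and ?T = "{c \<in> points A F (\<lambda>_. True) e. adjacent k L d c p q}"
  have c0: "c v = 0" if "c \<in> ?S" "v \<in> B" for c v
    using that e(1) by (auto simp: points_def B_def)
  have cF: "c (Coef r a b j) \<in> F" "c (Lam a) \<in> F" if "c \<in> ?S" for c r a b j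
  proof -
    show "c (Coef r a b j) \<in> F"
      using that e(1) F(2) by (cases "Coef r a b j \<in> A - B") (auto simp: points_def)
    have "Lam a \<notin> A" by (auto simp: A_def coef_vars_def)
    then show "c (Lam a) \<in> F" using that e(2) by (auto simp: points_def)
  qed
  have "inj_on \<Phi> ?S"
  proof (rule inj_onI)
    fix c c' assume c: "c \<in> ?S" "c' \<in> ?S" "\<Phi> c = \<Phi> c'"
    show "c = c'"
    proof
      fix v
      show "c v = c' v"
        using c0[OF c(1), of v] c0[OF c(2), of v] \<Phi>nB[of v c] \<Phi>nB[of v c'] c(3) by (cases "v \<in> B") auto
    qed
  qed
  moreover have "\<Phi> ` ?S \<subseteq> ?T"
  proof (rule image_subsetI)
    fix c assume c: "c \<in> ?S"
    have ef: "edge_form k L d c r p q \<in> F" for r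
      by (rule edge_form_in) (use F cF[OF c] p in auto)
    have "\<Phi> c \<in> points A F (\<lambda>_. True) e"
    proof -
      have "\<Phi> c v = e v" if "v \<notin> A" for v
        using that B(1) \<Phi>nB[of v c] c by (auto simp: points_def)
      moreover have "\<Phi> c v \<in> F" if "v \<in> A" for v
      proof (cases "v \<in> B")
        case True
        then obtain r where "r < k - 1" "v = Coef r 0 0 0" by (auto simp: B_def)
        then show ?thesis using \<Phi>B F(6)[OF ef] by simp
      next
        case False
        then show ?thesis using \<Phi>nB[of v c] c that by (auto simp: points_def)
      qed
      ultimately show ?thesis by (auto simp: points_def)
    qed
    moreover have "edge_form k L d (\<Phi> c) r p q = 0" if r: "r < k - 1" for r
    proof -
      let ?J = "{..<L} \<times> {..<L} \<times> {..<d}"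
      let ?f = "\<lambda>c (a, b, j). c (Coef r a b j) * weight k (c (Lam a)) (c (Lam b)) p q ^ j"
      have J: "(0, 0, 0) \<in> ?J" "finite ?J" using Ld by auto
      have "sum (?f (\<Phi> c)) (?J - {(0, 0, 0)}) = sum (?f c) (?J - {(0, 0, 0)})"
      proof (rule sum.cong[OF refl])
        fix abj assume abj: "abj \<in> ?J - {(0, 0, 0)}"
        obtain a b j where [simp]: "abj = (a, b, j)" by (metis prod_cases3)
        have "Coef r a b j \<notin> B" "Lam a \<notin> B" "Lam b \<notin> B" using abj by (auto simp: B_def)
        then show "?f (\<Phi> c) abj = ?f c abj" by (simp add: \<Phi>nB)
      qed
      moreover have "Coef r 0 0 0 \<in> B" using r by (simp add: B_def)
      ultimately show ?thesis
        using sum.remove[OF J(2,1), of "?f (\<Phi> c)"] sum.remove[OF J(2,1), of "?f c"]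
          \<Phi>B[OF r, of c] c0[OF c]
        by (simp add: edge_form_def)
    qed
    ultimately show "\<Phi> c \<in> ?T" by (auto simp: adjacent_def)
  qed
  moreover have "finite ?T" using finite_points[OF finA F(1)] by auto
  ultimately have "card ?S \<le> card ?T" by (rule card_inj_on_le)
  moreover have "card ?S = card F ^ (card A - (k - 1))"
    using card_points_True[of "A - B" F e] finA F(1) B finite_subset[OF B(1) finA]
    by (simp add: card_Diff_subset)
  ultimately show ?thesis by simp
qed

definition coord_graph :: "nat \<Rightarrow> nat \<Rightarrow> nat \<Rightarrow> 'a::comm_ring_1 set \<Rightarrow> (var \<Rightarrow> 'a) \<Rightarrow> (nat \<Rightarrow> 'a) sgraph" where
  "coord_graph k L d F c = \<lparr>verts = (\<Pi>\<^sub>E l\<in>{..<k}. F),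
     edges = {{p, q} | p q. p \<in> (\<Pi>\<^sub>E l\<in>{..<k}. F) \<and> q \<in> (\<Pi>\<^sub>E l\<in>{..<k}. F) \<and> p \<noteq> q
        \<and> adjacent k L d c p q}\<rparr>"

lemma coord_graph_edgeE:
  assumes "ed \<in> edges (coord_graph k L d F c)"
  obtains p q where "ed = {p, q}" "p \<in> (\<Pi>\<^sub>E l\<in>{..<k}. F)" "q \<in> (\<Pi>\<^sub>E l\<in>{..<k}. F)" "p \<noteq> q"
    "adjacent k L d c p q"
  using assms unfolding coord_graph_def sgraph.simps by blast

lemma coord_graph_simple:
  assumes "finite F"
  shows "finite_simple_graph (coord_graph k L d F c)"
proof -
  have "ed \<subseteq> verts (coord_graph k L d F c) \<and> card ed = 2"
    if "ed \<in> edges (coord_graph k L d F c)" for ed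
  proof -
    obtain p q where "ed = {p, q}" "p \<in> (\<Pi>\<^sub>E l\<in>{..<k}. F)" "q \<in> (\<Pi>\<^sub>E l\<in>{..<k}. F)" "p \<noteq> q"
      using coord_graph_edgeE[OF \<open>ed \<in> _\<close>] by metis
    then show ?thesis unfolding coord_graph_def sgraph.simps by simp
  qed
  moreover have "finite (verts (coord_graph k L d F c))"
    using assms unfolding coord_graph_def sgraph.simps by (intro finite_PiE) auto
  ultimately show ?thesis unfolding finite_simple_graph_def by blast
qed

lemma card_verts_coord_graph: "card (verts (coord_graph k L d F c)) = card F ^ k"
  by (simp add: coord_graph_def card_PiE)

lemma card_edges_coord_graph:
  fixes F :: "'a::comm_ring_1 set"
  assumes "finite F"
  shows "card {(p, q). p \<in> (\<Pi>\<^sub>E l\<in>{..<k}. F) \<and> q \<in> (\<Pi>\<^sub>E l\<in>{..<k}. F) \<and> p \<noteq> q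
      \<and> adjacent k L d c p q} \<le> 2 * card (edges (coord_graph k L d F c))" (is "card ?O \<le> 2 * card ?E")
proof -
  have simple: "finite_simple_graph (coord_graph k L d F c)" by (rule coord_graph_simple[OF assms])
  then have "?E \<subseteq> Pow (verts (coord_graph k L d F c))" "finite (verts (coord_graph k L d F c))"
    by (auto simp: finite_simple_graph_def)
  then have finE: "finite ?E" by (meson finite_Pow_iff finite_subset)
  let ?R = "\<lambda>ed. {(p, q). p \<noteq> q \<and> {p, q} = ed} :: ((nat \<Rightarrow> 'a) \<times> (nat \<Rightarrow> 'a)) set"
  have R: "finite (?R ed) \<and> card (?R ed) \<le> 2" if ed: "ed \<in> ?E" for ed
  proof -
    obtain p q where pq: "ed = {p, q}" using coord_graph_edgeE[OF ed] by metis
    have sub: "?R ed \<subseteq> {(p, q), (q, p)}" unfolding pq doubleton_eq_iff by blast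
    have fin: "finite {(p, q), (q, p)}" by (intro finite.intros)
    have "card (?R ed) \<le> card {(p, q), (q, p)}" by (rule card_mono[OF fin sub])
    also have "\<dots> \<le> length [(p, q), (q, p)]" using card_length[of "[(p, q), (q, p)]"] by (simp only: list.set)
    finally have "card (?R ed) \<le> 2" by (simp only: list.size)
    then show ?thesis using finite_subset[OF sub fin] by (rule conjI[rotated])
  qed
  have "?O \<subseteq> (\<Union>ed\<in>?E. ?R ed)" unfolding coord_graph_def sgraph.simps by blast
  then have "card ?O \<le> card (\<Union>ed\<in>?E. ?R ed)"
    using finE R by (intro card_mono finite_UN_I) blast+
  also have "\<dots> \<le> (\<Sum>ed\<in>?E. card (?R ed))" by (rule card_UN_le[OF finE])
  also have "\<dots> \<le> (\<Sum>ed\<in>?E. 2)" by (rule sum_mono) (use R in blast)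
  finally show ?thesis by simp
qed

definition with_ends :: "nat \<Rightarrow> (var \<Rightarrow> 'a::zero) \<Rightarrow> (nat \<Rightarrow> 'a) \<Rightarrow> (nat \<Rightarrow> 'a) \<Rightarrow> var \<Rightarrow> 'a" where
  "with_ends k c p q v = (case v of Pt i l \<Rightarrow> if i = 0 then p l else if i = k then q l else 0 | _ \<Rightarrow> c v)"

lemma coord_graph_theta_free:
  fixes c :: "var \<Rightarrow> 'a::comm_ring_1"
  assumes k: "k \<ge> 2"
    and good: "\<And>p q. p \<in> (\<Pi>\<^sub>E l\<in>{..<k}. F) \<Longrightarrow> q \<in> (\<Pi>\<^sub>E l\<in>{..<k}. F) \<Longrightarrow> p \<noteq> q \<Longrightarrow>
      \<not> infinite_in (inner_vars k) (is_path k L d) (with_ends k c p q)"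
    and C: "\<forall>e :: var \<Rightarrow> 'a. \<not> infinite_in (inner_vars k) (is_path k L d) e \<longrightarrow>
      finite {z. agree_off (inner_vars k) e z \<and> is_path k L d z}
      \<and> card {z. agree_off (inner_vars k) e z \<and> is_path k L d z} \<le> C"
    and P: "\<And>i. i < C + 1 \<Longrightarrow> inj_on (P i) {..k} \<and> P i 0 = x \<and> P i k = y
        \<and> (\<forall>j<k. {P i j, P i (Suc j)} \<in> edges (coord_graph k L d F c))"
    and inj: "inj_on (\<lambda>i. P i (1 :: nat)) {..<C + 1}"
  shows False
proof -
  let ?V = "\<Pi>\<^sub>E l\<in>{..<k}. F"
  have edge: "P i j \<in> ?V" "P i (Suc j) \<in> ?V" "adjacent k L d c (P i j) (P i (Suc j))"
    if "i < C + 1" "j < k" for i j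
  proof -
    have "{P i j, P i (Suc j)} \<in> edges (coord_graph k L d F c)" using P that by blast
    then obtain p q where pq: "{P i j, P i (Suc j)} = {p, q}" "p \<in> ?V" "q \<in> ?V" "adjacent k L d c p q"
      using coord_graph_edgeE by metis
    then have "P i j = p \<and> P i (Suc j) = q \<or> P i j = q \<and> P i (Suc j) = p"
      by (simp add: doubleton_eq_iff)
    then show "P i j \<in> ?V" "P i (Suc j) \<in> ?V" "adjacent k L d c (P i j) (P i (Suc j))"
      using pq adjacent_commute by metis+
  qed
  have PV: "P i j \<in> ?V" if "i < C + 1" "j \<le> k" for i j
    using edge[of i j] edge[of i "j - 1"] that k by (cases "j < k") auto
  have neq: "\<exists>l<k. p l \<noteq> q l" if "p \<in> ?V" "q \<in> ?V" "p \<noteq> q" for p q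
    using PiE_ext[OF that(1,2)] that(3) by blast
  have xy: "x \<in> ?V" "y \<in> ?V" "x \<noteq> y"
  proof -
    show "x \<in> ?V" "y \<in> ?V" using PV[of 0 0] PV[of 0 k] P[of 0] by auto
    show "x \<noteq> y" using P[of 0] k by (auto dest: inj_onD[of _ _ 0 k])
  qed
  let ?e = "with_ends k c x y"
  let ?Z = "{z. agree_off (inner_vars k) ?e z \<and> is_path k L d z}"
  define z where "z i v = (case v of Pt j l \<Rightarrow> if 1 \<le> j \<and> j < k \<and> l < k then P i j l else ?e v | _ \<Rightarrow> c v)"
    for i v
  have zP: "z i (Pt j l) = P i j l" if "i < C + 1" "j \<le> k" "l < k" for i j l
    using P[OF that(1)] that k by (auto simp: z_def with_ends_def)
  have zc: "z i (Coef r a b j) = c (Coef r a b j)" "z i (Lam a) = c (Lam a)" for i r a b j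
    by (auto simp: z_def)
  have zZ: "z i \<in> ?Z" if i: "i < C + 1" for i
  proof -
    have "z i v = ?e v" if v: "v \<notin> inner_vars k" for v
    proof (cases v)
      case (Pt j l)
      then have "\<not> (1 \<le> j \<and> j < k \<and> l < k)" using v by (auto simp: inner_vars_def image_iff)
      then show ?thesis using Pt by (auto simp: z_def)
    qed (auto simp: z_def with_ends_def)
    then have "agree_off (inner_vars k) ?e (z i)" by (simp add: agree_off_def)
    moreover have "is_path k L d (z i)"
      unfolding is_path_def
    proof (intro conjI ballI)
      fix j assume j: "j \<in> {..<k}"
      have "edge_form k L d (z i) r (vert (z i) j) (vert (z i) (Suc j))
          = edge_form k L d c r (P i j) (P i (Suc j))" for r
        by (rule edge_form_cong) (use i j in \<open>auto simp: zc zP\<close>)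
      then show "adjacent k L d (z i) (vert (z i) j) (vert (z i) (Suc j))"
        using edge(3)[OF i, of j] j by (simp add: adjacent_def)
    next
      fix j j' assume j: "j \<in> {..k}" "j' \<in> {..k} - {j}"
      then have "P i j \<noteq> P i j'" using P[OF i] by (auto dest: inj_onD)
      then obtain l where "l < k" "P i j l \<noteq> P i j' l" using neq PV[OF i] j by blast
      then show "\<exists>l\<in>{..<k}. z i (Pt j l) \<noteq> z i (Pt j' l)" using zP[OF i] j by auto
    qed
    ultimately show ?thesis by blast
  qed
  have "inj_on z {..<C + 1}"
  proof (rule inj_onI)
    fix i i' assume i: "i \<in> {..<C + 1}" "i' \<in> {..<C + 1}" "z i = z i'"
    have "P i 1 l = P i' 1 l" if "l < k" for l
      using zP[of i 1 l] zP[of i' 1 l] i that k by auto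
    then have "P i 1 = P i' 1" using neq[of "P i 1" "P i' 1"] PV[of i 1] PV[of i' 1] i k by auto
    then show "i = i'" using inj i by (auto dest: inj_onD)
  qed
  then have "card (z ` {..<C + 1}) = C + 1" by (simp add: card_image)
  moreover have "z ` {..<C + 1} \<subseteq> ?Z" using zZ by blast
  moreover have "finite ?Z" "card ?Z \<le> C" using C good[OF xy] by blast+
  ultimately show False using card_mono[of ?Z "z ` {..<C + 1}"] by simp
qed

section \<open>Averaging\<close>

lemma card_bad_le:
  fixes F :: "dom set" and e :: "var \<Rightarrow> dom"
  assumes "finite F" "F \<noteq> {}" "k \<ge> 2" "s \<ge> 1" "d = s * k" "L = (s * k + 2)\<^sup>2 * k + 1"
    and vs: "set vs = coef_vars k L d" "distinct vs"
    and n: "n = card (coef_vars k L d) - s + 1"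
    and lam: "inj_on (\<lambda>a. e (Lam a)) {..<L}"
    and D: "\<forall>F (e :: var \<Rightarrow> dom). finite F \<longrightarrow> \<not> dim_ge vs n (bad k L d) e
      \<longrightarrow> card (points (set vs) F (bad k L d) e) * card F \<le> D * card F ^ n"
  shows "card {c \<in> points (coef_vars k L d) F (\<lambda>_. True) e. bad k L d (with_ends k c p q)}
    \<le> D * card F ^ (card (coef_vars k L d) - s)"
proof -
  let ?A = "coef_vars k L d" and ?w = "\<lambda>c. with_ends k c p q"
  have "inj_on (\<lambda>a. ?w e (Lam a)) {..<L}" using lam by (simp add: with_ends_def)
  then have "\<not> dim_ge vs n (bad k L d) (?w e)"
    by (intro bad_dim[OF uncountable_dom, where s = s]) (use assms in auto)
  then have le: "card (points ?A F (bad k L d) (?w e)) * card F \<le> D * card F ^ n"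
    using D assms(1) vs(1) by auto
  have "inj_on ?w {c \<in> points ?A F (\<lambda>_. True) e. bad k L d (?w c)}"
  proof (rule inj_onI)
    fix c c' assume c: "c \<in> {c \<in> points ?A F (\<lambda>_. True) e. bad k L d (?w c)}"
      "c' \<in> {c \<in> points ?A F (\<lambda>_. True) e. bad k L d (?w c)}" "?w c = ?w c'"
    show "c = c'"
    proof
      fix v
      show "c v = c' v"
      proof (cases v)
        case (Pt i l)
        then have "v \<notin> ?A" by (auto simp: coef_vars_def)
        then show ?thesis using c(1,2) by (simp add: points_def)
      qed (use fun_cong[OF c(3), of v] in \<open>simp_all add: with_ends_def\<close>)
    qed
  qed
  moreover have "?w ` {c \<in> points ?A F (\<lambda>_. True) e. bad k L d (?w c)} \<subseteq> points ?A F (bad k L d) (?w e)"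
  proof (rule image_subsetI)
    fix c assume c: "c \<in> {c \<in> points ?A F (\<lambda>_. True) e. bad k L d (?w c)}"
    have "?w c v = ?w e v" if "v \<notin> ?A" for v
      using c that by (cases v) (auto simp: with_ends_def points_def)
    moreover have "?w c v \<in> F" if "v \<in> ?A" for v
    proof -
      obtain r a b j where "v = Coef r a b j" using \<open>v \<in> ?A\<close> by (auto simp: coef_vars_def)
      then show ?thesis using c that by (simp add: with_ends_def points_def)
    qed
    ultimately show "?w c \<in> points ?A F (bad k L d) (?w e)" using c by (simp add: points_def)
  qed
  ultimately have "card {c \<in> points ?A F (\<lambda>_. True) e. bad k L d (?w c)}
      \<le> card (points ?A F (bad k L d) (?w e))"
    by (rule card_inj_on_le) (rule finite_points[OF finite_coef_vars assms(1)])
  then have "card {c \<in> points ?A F (\<lambda>_. True) e. bad k L d (?w c)} * card F \<le> D * card F ^ n"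
    using le mult_le_mono1 order_trans by blast
  then have "card {c \<in> points ?A F (\<lambda>_. True) e. bad k L d (?w c)} * card F
      \<le> (D * card F ^ (card ?A - s)) * card F"
    by (simp add: n)
  moreover have "card F > 0" using assms(1,2) by (simp add: card_gt_0_iff)
  ultimately show ?thesis by simp
qed

lemma averaging_arith:
  fixes q D a k w b :: nat
  assumes q: "4 * D < q" "2 \<le> q" and a: "4 * k \<le> a" "1 \<le> k"
    and w: "(q ^ k) * (q ^ k) \<le> w + q ^ k"
    and b: "b \<le> (q ^ k * q ^ k) * (D * q ^ (a - 4 * k))"
    and le: "4 * (w * q ^ (a - (k - 1))) \<le> q ^ a * q ^ (k + 1) + 4 * (q ^ k * q ^ k) * b"
  shows False
proof -
  have "2 * q ^ k \<le> q ^ k * q ^ k"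
    using self_le_power[of q k] q a by (intro mult_le_mono1) auto
  then have "q ^ k * q ^ k \<le> 2 * w" using w by linarith
  then have "2 * ((q ^ k * q ^ k) * q ^ (a - (k - 1))) \<le> 4 * (w * q ^ (a - (k - 1)))"
    using mult_le_mono1[of "q ^ k * q ^ k" "2 * w" "2 * q ^ (a - (k - 1))"] by (simp add: algebra_simps)
  moreover have "k + k + (a - (k - 1)) = a + (k + 1)" using a by simp
  then have "(q ^ k * q ^ k) * q ^ (a - (k - 1)) = q ^ a * q ^ (k + 1)"
    by (simp only: power_add[symmetric])
  moreover have "4 * (q ^ k * q ^ k) * b \<le> 4 * D * q ^ a"
  proof -
    have "4 * (q ^ k * q ^ k) * b \<le> 4 * (q ^ k * q ^ k) * ((q ^ k * q ^ k) * (D * q ^ (a - 4 * k)))"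
      using b by (rule mult_le_mono2)
    also have "\<dots> = 4 * D * (q ^ k * q ^ k * q ^ k * q ^ k * q ^ (a - 4 * k))"
      by (simp only: ac_simps)
    also have "q ^ k * q ^ k * q ^ k * q ^ k * q ^ (a - 4 * k) = q ^ (k + k + k + k + (a - 4 * k))"
      by (simp only: power_add)
    also have "k + k + k + k + (a - 4 * k) = a" using a by simp
    finally show ?thesis .
  qed
  ultimately have "q ^ a * q ^ (k + 1) \<le> 4 * D * q ^ a" using le by linarith
  then have "q ^ a * q ^ (k + 1) \<le> q ^ a * (4 * D)" by (simp only: mult.commute)
  then have "q ^ (k + 1) \<le> 4 * D" using q by simp
  moreover have "q \<le> q ^ (k + 1)" using q by (intro self_le_power) auto
  ultimately show False using q by linarith
qed

lemma extremal_number_theta_ge: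
  assumes k: "k \<ge> 2"
  shows "\<exists>l\<ge>1. \<exists>q0 :: nat. \<forall>t n. q0 \<le> 2 ^ t \<longrightarrow> (2 ^ t) ^ k \<le> n \<longrightarrow>
    (2 ^ t) ^ (k + 1) \<le> 8 * extremal_number n (theta k l)"
proof -
  define s where "s = 4 * k"
  define d where "d = s * k"
  define L where "L = (s * k + 2)\<^sup>2 * k + 1"
  define A where "A = coef_vars k L d"
  define a where "a = card A"
  define n where "n = a - s + 1"
  have Ld: "L \<ge> 1" "d \<ge> s" using k by (auto simp: L_def d_def)
  have "a \<ge> 4 * k"
  proof -
    have "d \<le> L * (L * d)" using Ld(1) by simp
    also have "\<dots> \<le> (k - 1) * (L * (L * d))"
    proof -
      have "1 \<le> k - 1" using k by linarith
      then have "1 * (L * (L * d)) \<le> (k - 1) * (L * (L * d))" by (rule mult_le_mono1)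
      then show ?thesis by simp
    qed
    finally show ?thesis using Ld(2) unfolding a_def A_def card_coef_vars s_def by linarith
  qed
  obtain vs where vs: "set vs = A" "distinct vs"
    using finite_distinct_list[OF finite_coef_vars] unfolding A_def by blast
  obtain D where D: "\<forall>F (e :: var \<Rightarrow> dom). finite F \<longrightarrow> \<not> dim_ge vs n (bad k L d) e
      \<longrightarrow> card (points (set vs) F (bad k L d) e) * card F \<le> D * card F ^ n"
    using card_points_le[OF definable_bad vs(2)] by blast
  obtain C where C: "\<forall>e :: var \<Rightarrow> dom. \<not> bad k L d e \<longrightarrow>
      finite {z. agree_off (inner_vars k) e z \<and> is_path k L d z}
      \<and> card {z. agree_off (inner_vars k) e z \<and> is_path k L d z} \<le> C"
    using not_infinite_in_bound[OF finite_inner_vars definable_is_path] by blast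
  have "(2 ^ t) ^ (k + 1) \<le> 8 * extremal_number m (theta k (C + 1))"
    if t: "L + 4 * D + 2 \<le> 2 ^ t" and m: "(2 ^ t) ^ k \<le> m" for t m
  proof -
    define q where "q = (2 :: nat) ^ t"
    define F where "F = subfield2 t"
    have "t \<ge> 1" using t by (cases t) auto
    then have cF: "card F = q" unfolding F_def q_def by (rule card_subfield2)
    have q: "L \<le> q" "4 * D < q" "2 \<le> q" using t by (auto simp: q_def)
    have finF: "finite F" using cF q by (metis card.infinite not_numeral_le_zero)
    have F0: "F \<noteq> {}" using cF q by auto
    obtain lam where lam: "inj_on lam {..<L}" "lam ` {..<L} \<subseteq> F"
      using card_le_inj[of "{..<L}" F] finF cF q by auto
    define e :: "var \<Rightarrow> dom" where
      "e v = (case v of Lam b \<Rightarrow> if b < L then lam b else 0 | _ \<Rightarrow> 0)" for v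
    have eL: "inj_on (\<lambda>b. e (Lam b)) {..<L}" "\<And>b. e (Lam b) \<in> F"
    proof -
      show "inj_on (\<lambda>b. e (Lam b)) {..<L}"
        using lam(1) by (auto simp: e_def inj_on_def)
      show "e (Lam b) \<in> F" for b
        using lam(2) subfield2_closed(1)[of t] by (auto simp: e_def F_def)
    qed
    define Cs where "Cs = points A F (\<lambda>_. True) e"
    have Cs: "finite Cs" "card Cs = q ^ a"
      unfolding Cs_def a_def A_def cF[symmetric]
      by (rule finite_points[OF finite_coef_vars finF], rule card_points_True[OF finite_coef_vars finF])
    define V where "V = (\<Pi>\<^sub>E l\<in>{..<k}. F)"
    have V: "finite V" "card V = q ^ k"
      unfolding V_def using finF cF by (auto simp: card_PiE intro: finite_PiE)
    define W where "W = {w \<in> V \<times> V. fst w \<noteq> snd w}"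
    have finW: "finite W" using V by (simp add: W_def)
    have cW: "card W \<le> q ^ k * q ^ k" "q ^ k * q ^ k \<le> card W + q ^ k"
    proof -
      have cVV: "card (V \<times> V) = q ^ k * q ^ k" using V by (simp add: card_cartesian_product)
      have "card W \<le> card (V \<times> V)" by (rule card_mono) (use V in \<open>auto simp: W_def\<close>)
      then show "card W \<le> q ^ k * q ^ k" using cVV by simp
      have "V \<times> V \<subseteq> W \<union> (\<lambda>p. (p, p)) ` V" unfolding W_def by auto
      then have "card (V \<times> V) \<le> card (W \<union> (\<lambda>p. (p, p)) ` V)"
        by (rule card_mono[rotated]) (use V finW in simp)
      also have "\<dots> \<le> card W + card ((\<lambda>p. (p, p)) ` V)" by (rule card_Un_le)
      also have "\<dots> \<le> card W + q ^ k" using card_image_le[OF V(1), of "\<lambda>p. (p, p)"] V(2) by simp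
      finally show "q ^ k * q ^ k \<le> card W + q ^ k" using cVV by simp
    qed
    define nE where "nE c = card {w \<in> W. adjacent k L d c (fst w) (snd w)}" for c
    define B where "B = {c \<in> Cs. \<exists>w\<in>W. bad k L d (with_ends k c (fst w) (snd w))}"
    have sumE: "card W * q ^ (a - (k - 1)) \<le> (\<Sum>c\<in>Cs. nE c)"
    proof -
      have "q ^ (a - (k - 1)) \<le> card {c \<in> Cs. adjacent k L d c (fst w) (snd w)}" if w: "w \<in> W" for w
      proof -
        note sf = subfield2_closed[where t = t, folded F_def]
        have d1: "d \<ge> 1" using Ld(2) k by (simp add: s_def)
        have e0: "e (Coef r a b j) = 0" for r a b j by (simp add: e_def)
        have wF: "fst w l \<in> F" "snd w l \<in> F" if "l < k" for l
        proof -
          have "fst w \<in> V" "snd w \<in> V" using w by (auto simp: W_def)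
          then show "fst w l \<in> F" "snd w l \<in> F"
            using PiE_mem[of _ "{..<k}" "\<lambda>_. F" l] \<open>l < k\<close> unfolding V_def by auto
        qed
        show ?thesis
          unfolding Cs_def A_def a_def cF[symmetric]
          by (rule card_adjacent_ge[where F = F and e = e and p = "fst w" and q = "snd w",
                OF finF sf(1) sf(5) sf(2) sf(3) sf(4) Ld(1) d1 e0 eL(2) wF])
      qed
      then have "(\<Sum>w\<in>W. q ^ (a - (k - 1))) \<le> (\<Sum>w\<in>W. card {c \<in> Cs. adjacent k L d c (fst w) (snd w)})"
        by (rule sum_mono)
      also have "\<dots> = (\<Sum>c\<in>Cs. nE c)"
        unfolding nE_def by (rule sum_multicount_gen[symmetric]) (use Cs finW in auto)
      finally show ?thesis by simp
    qed
    have cB: "card B \<le> (q ^ k * q ^ k) * (D * q ^ (a - 4 * k))"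
    proof -
      have "B = (\<Union>w\<in>W. {c \<in> Cs. bad k L d (with_ends k c (fst w) (snd w))})"
        unfolding B_def by blast
      then have "card B \<le> (\<Sum>w\<in>W. card {c \<in> Cs. bad k L d (with_ends k c (fst w) (snd w))})"
        using card_UN_le[OF finW] by simp
      also have "\<dots> \<le> (\<Sum>w\<in>W. D * q ^ (a - s))"
        unfolding Cs_def A_def a_def cF[symmetric]
        by (intro sum_mono card_bad_le[OF finF F0 k _ d_def L_def _ vs(2) _ eL(1) D])
          (use k vs in \<open>auto simp: s_def n_def a_def A_def\<close>)
      also have "\<dots> \<le> (q ^ k * q ^ k) * (D * q ^ (a - s))"
        using cW(1) by (simp del: mult_le_cancel2 add: mult_le_mono1)
      finally show ?thesis by (simp add: s_def)
    qed
    have "\<exists>c\<in>Cs - B. q ^ (k + 1) \<le> 4 * nE c"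
    proof (rule ccontr)
      assume "\<not> ?thesis"
      then have small: "4 * nE c \<le> q ^ (k + 1)" if "c \<in> Cs - B" for c using that by (meson nle_le)
      have nE: "nE c \<le> q ^ k * q ^ k" for c
      proof -
        have "nE c \<le> card W" unfolding nE_def by (rule card_mono[OF finW]) auto
        then show ?thesis using cW(1) by simp
      qed
      have BC: "B \<subseteq> Cs" by (auto simp: B_def)
      have "4 * (\<Sum>c\<in>Cs. nE c) = (\<Sum>c\<in>Cs. 4 * nE c)" by (rule sum_distrib_left)
      also have "\<dots> = (\<Sum>c\<in>Cs - B. 4 * nE c) + (\<Sum>c\<in>B. 4 * nE c)"
        by (rule sum.subset_diff[OF BC Cs(1)])
      also have "\<dots> \<le> (\<Sum>c\<in>Cs - B. q ^ (k + 1)) + (\<Sum>c\<in>B. 4 * (q ^ k * q ^ k))"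
        by (intro add_mono sum_mono small mult_le_mono2 nE)
      also have "\<dots> = card (Cs - B) * q ^ (k + 1) + 4 * (q ^ k * q ^ k) * card B"
        by (simp add: mult.commute)
      also have "\<dots> \<le> q ^ a * q ^ (k + 1) + 4 * (q ^ k * q ^ k) * card B"
        using card_mono[OF Cs(1), of "Cs - B"] Cs(2) by (intro add_right_mono mult_le_mono1) auto
      finally have "4 * (card W * q ^ (a - (k - 1))) \<le> q ^ a * q ^ (k + 1) + 4 * (q ^ k * q ^ k) * card B"
        using sumE by linarith
      then show False
        using averaging_arith[OF q(2,3) \<open>a \<ge> 4 * k\<close> _ cW(2) cB] k by simp
    qed
    then obtain c where c: "c \<in> Cs - B" "q ^ (k + 1) \<le> 4 * nE c" by blast
    let ?G = "coord_graph k L d F c"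
    have "{w \<in> W. adjacent k L d c (fst w) (snd w)} =
      {(p, p'). p \<in> V \<and> p' \<in> V \<and> p \<noteq> p' \<and> adjacent k L d c p p'}"
      unfolding W_def by auto
    then have "nE c \<le> 2 * card (edges ?G)"
      unfolding nE_def V_def using card_edges_coord_graph[OF finF, of k L d c] by simp
    moreover have "card (edges ?G) \<le> extremal_number m (theta k (C + 1))"
    proof (rule extremal_number_ge)
      show "finite_simple_graph ?G" by (rule coord_graph_simple[OF finF])
      show "card (verts ?G) \<le> m" using m by (simp add: card_verts_coord_graph cF q_def)
      fix P x y
      assume P: "\<And>i. i < C + 1 \<Longrightarrow> inj_on (P i) {..k} \<and> P i 0 = x \<and> P i k = y
        \<and> (\<forall>j<k. {P i j, P i (Suc j)} \<in> edges ?G)" and inj: "inj_on (\<lambda>i. P i 1) {..<C + 1}"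
      have good: "\<not> bad k L d (with_ends k c p p')" if "p \<in> V" "p' \<in> V" "p \<noteq> p'" for p p'
      proof -
        have "(p, p') \<in> W" using that by (simp add: W_def)
        then show ?thesis using c(1) unfolding B_def by force
      qed
      show False
        by (rule coord_graph_theta_free[OF k good[unfolded V_def] C P inj])
    qed (use k in auto)
    ultimately show ?thesis using c(2) unfolding q_def by linarith
  qed
  then show ?thesis by (intro exI[of _ "C + 1"] conjI exI[of _ "L + 4 * D + 2"] allI impI) auto
qed

theorem theorem1:
  fixes k :: nat
  assumes "k \<ge> 2"
  shows "\<exists>l::nat. l \<ge> 1 \<and> (\<exists>c::real. c > 0 \<and>
    (\<forall>\<^sub>F n in sequentially.
       real (extremal_number n (theta k l)) \<ge> c * real n powr (1 + 1 / real k)))"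
proof -
  obtain l and q0 :: nat where l: "l \<ge> 1" and ex: "\<And>t n. q0 \<le> 2 ^ t \<Longrightarrow> (2 ^ t) ^ k \<le> n \<Longrightarrow>
    (2 ^ t) ^ (k + 1) \<le> 8 * extremal_number n (theta k l)"
    using extremal_number_theta_ge[OF assms] by blast
  define c :: real where "c = 1 / (8 * 2 ^ (k + 1))"
  have "c * real n powr (1 + 1 / real k) \<le> real (extremal_number n (theta k l))"
    if n: "(2 * q0) ^ k + 1 \<le> n" for n :: nat
  proof -
    have "\<exists>t. (2 ^ t) ^ k \<le> n \<and> n < (2 ^ Suc t) ^ k"
    proof -
      let ?P = "\<lambda>t. n < (2 ^ t) ^ k"
      have "n < 2 ^ n" by (rule less_exp)
      also have "\<dots> \<le> (2 ^ n) ^ k" by (rule self_le_power) (use assms in auto)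
      finally have P: "?P n" .
      have "\<not> ?P 0" using n by simp
      then obtain t where "\<not> ?P t" "?P (Suc t)"
        using ex_least_nat_less[of ?P n] P by (metis lessI order_refl)
      then show ?thesis by (auto simp: not_less)
    qed
    then obtain t where t: "(2 ^ t) ^ k \<le> n" "n < (2 ^ Suc t) ^ k" by blast
    have "n < (2 * 2 ^ t) ^ k" using t(2) by (simp only: power_Suc)
    then have "(2 * q0) ^ k < (2 * 2 ^ t) ^ k" using n by linarith
    then have "2 * q0 < 2 * 2 ^ t" by (rule power_less_imp_less_base) simp
    then have "(2 ^ t) ^ (k + 1) \<le> 8 * extremal_number n (theta k l)" using ex t(1) by simp
    then have "real ((2 ^ t) ^ (k + 1)) \<le> real (8 * extremal_number n (theta k l))"
      by (rule of_nat_mono)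
    then have E: "(2 ^ t) ^ (k + 1) \<le> 8 * real (extremal_number n (theta k l))" by simp
    have npos: "real n > 0" using n by simp
    have "real n powr (1 / real k) \<le> 2 * 2 ^ t"
    proof -
      have "real n \<le> real ((2 ^ Suc t) ^ k)" using t(2) by (intro of_nat_mono) simp
      then have "real n \<le> (2 * 2 ^ t) ^ k" by simp
      then have "real n powr (1 / real k) \<le> ((2 * 2 ^ t) ^ k) powr (1 / real k)"
        by (intro powr_mono2) auto
      also have "(2 * 2 ^ t :: real) ^ k = (2 * 2 ^ t) powr real k"
        by (rule powr_realpow[symmetric]) simp
      also have "\<dots> powr (1 / real k) = (2 * 2 ^ t) powr (real k * (1 / real k))"
        by (rule powr_powr)
      also have "real k * (1 / real k) = 1" using assms by simp
      also have "(2 * 2 ^ t :: real) powr 1 = 2 * 2 ^ t" by (rule powr_one) simp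
      finally show ?thesis .
    qed
    then have "(real n powr (1 / real k)) ^ (k + 1) \<le> (2 * 2 ^ t) ^ (k + 1)"
      by (rule power_mono) simp
    moreover have "(real n powr (1 / real k)) ^ (k + 1) = real n powr (1 + 1 / real k)"
    proof -
      have "(real n powr (1 / real k)) ^ (k + 1) = (real n powr (1 / real k)) powr real (k + 1)"
        by (rule powr_realpow[symmetric]) (use npos in simp)
      also have "\<dots> = real n powr (1 + 1 / real k)"
        using assms by (simp add: powr_powr field_simps)
      finally show ?thesis .
    qed
    ultimately have "real n powr (1 + 1 / real k) \<le> 2 ^ (k + 1) * (2 ^ t) ^ (k + 1)"
      by (simp only: power_mult_distrib)
    also have "\<dots> \<le> 2 ^ (k + 1) * (8 * real (extremal_number n (theta k l)))"
      by (rule mult_left_mono[OF E]) simp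
    finally show ?thesis by (simp add: c_def field_simps)
  qed
  moreover have "c > 0" by (simp add: c_def)
  ultimately show ?thesis using l unfolding eventually_sequentially by blast
qed

end
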